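(* Let $k$ be a field of characteristic zero, $A=k[x_1,\dots,x_n]$, $m\in\{1,\dots,n\}$, and let $f_1,\dots,f_m\in A$ be algebraically independent over $k$. Put $R=k[f_1,\dots,f_m]$. The following are equivalent: (i) $\mathrm{dgcd}(f_1,\dots,f_m)\in k\setminus\{0\}$; (ii) $\operatorname{Irr}R\subset\operatorname{Sqf}A$, i.e. for every irreducible $w\in k[x_1,\dots,x_m]$ the polynomial $w(f_1,\dots,f_m)$ is square-free in $A$; (iii) $\operatorname{Sqf}R\subset\operatorname{Sqf}A$, i.e. for every square-free $w\in k[x_1,\dots,x_m]$ the polynomial $w(f_1,\dots,f_m)$ is square-free in $A$.
   Context: For $f_1,\dots,f_m\in k[x_1,\dots,x_n]$ ($m\le n$), $\mathrm{dgcd}(f_1,\dots,f_m)=\gcd\big(\det(\partial f_a/\partial x_{i_b})_{a,b=1}^m : 1\le i_1<\dots<i_m\le n\big)$, defined up to a nonzero constant factor. For a commutative ring $R$, $\operatorname{Irr}R$ is the set of irreducible elements of $R$ and $\operatorname{Sqf}R$ the set of square-free elements, where $a\in R$ is square-free if it cannot be written as $a=b^2c$ with $b,c\in R$ and $b$ not a unit of $R$. *)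

theory Defs
  imports "HOL-Analysis.Analysis" "HOL-Library.Poly_Mapping"
    "HOL-Computational_Algebra.Squarefree"
begin

text \<open>Polynomials over k in the variables indexed by a finite type 'v:
  k[x_v : v in 'v] is modelled as finitely supported maps from monomials
  (finitely supported exponent vectors 'v to nat) to coefficients in 'k.\<close>
type_synonym ('v, 'k) mpoly = "('v \<Rightarrow>\<^sub>0 nat) \<Rightarrow>\<^sub>0 'k"

definition mconst :: "'k::zero \<Rightarrow> ('v, 'k) mpoly" where
  "mconst c = Poly_Mapping.single 0 c"

definition mpderiv :: "'v \<Rightarrow> ('v, 'k::comm_semiring_1) mpoly \<Rightarrow> ('v, 'k) mpoly" where
  "mpderiv j p = (\<Sum>mon\<in>Poly_Mapping.keys p.
      Poly_Mapping.single (mon - Poly_Mapping.single j (1::nat))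
        (of_nat (Poly_Mapping.lookup (mon :: 'v \<Rightarrow>\<^sub>0 nat) j) * Poly_Mapping.lookup p mon))"

definition msubst :: "('m::finite, 'k::comm_semiring_1) mpoly \<Rightarrow> ('m \<Rightarrow> ('n, 'k) mpoly) \<Rightarrow> ('n, 'k) mpoly" where
  "msubst w f = (\<Sum>mon\<in>Poly_Mapping.keys w. mconst (Poly_Mapping.lookup w mon) * (\<Prod>a\<in>UNIV. f a ^ Poly_Mapping.lookup mon a))"

definition alg_indep :: "('m::finite \<Rightarrow> ('n, 'k::comm_semiring_1) mpoly) \<Rightarrow> bool" where
  "alg_indep f \<longleftrightarrow> (\<forall>w :: ('m, 'k) mpoly. msubst w f = 0 \<longrightarrow> w = 0)"

definition jac_minor :: "('m::finite \<Rightarrow> ('n, 'k::comm_ring_1) mpoly) \<Rightarrow> ('m \<Rightarrow> 'n) \<Rightarrow> ('n, 'k) mpoly" where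
  "jac_minor f i = det (\<chi> a b. mpderiv (i b) (f a))"

definition is_dgcd :: "('m::finite \<Rightarrow> ('n, 'k::comm_ring_1) mpoly) \<Rightarrow> ('n, 'k) mpoly \<Rightarrow> bool" where
  "is_dgcd f d \<longleftrightarrow>
     (\<forall>i. inj i \<longrightarrow> d dvd jac_minor f i) \<and>
     (\<forall>e. (\<forall>i. inj i \<longrightarrow> e dvd jac_minor f i) \<longrightarrow> e dvd d)"

end

theory Submission
  imports Defs "HOL-Computational_Algebra.Polynomial"
begin

text \<open>
  Fix a prime g of A and let P be the prime ideal of all polynomials u over k in the variables
  indexed by 'm with g dividing u(f). The theorem reduces to the claim that g fails to divide some
  maximal minor of the Jacobian matrix J of f if and only if no irreducible w satisfies
  \<open>g\<^sup>2 dvd w(f)\<close>.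

  If some minor is nonzero modulo g, then J is injective on row vectors over A/g. For u in P with
  u(f) = g h this makes the gradient of u at f proportional to h times a fixed vector modulo g,
  which forces P to be principal, generated by a prime r whose gradient does not vanish modulo g.
  Now \<open>g\<^sup>2 dvd w(f)\<close> puts w and its partial derivatives into P, so \<open>r\<^sup>2 dvd w\<close>.

  Conversely, suppose that no irreducible w has \<open>g\<^sup>2 dvd w(f)\<close>. Then every w with
  \<open>g\<^sup>2 dvd w(f)\<close> is a product of two elements of P. If P had height at least two, it would
  contain suitable r and v for which \<open>v\<^sup>2 + r\<^sup>3\<close> is not such a product; hence P is zero or
  generated by one r. In characteristic zero the tangent vectors to P at f lie in the column space of
  J modulo g, and since r(f) / g is prime to g, one column of J is not tangent. So J has a right inverse
  modulo g, up to a factor prime to g, and its maximal minors cannot all vanish modulo g.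
\<close>

section \<open>Polynomial rings as rings of finitely supported maps\<close>

abbreviation lookup :: "('a \<Rightarrow>\<^sub>0 'b::zero) \<Rightarrow> 'a \<Rightarrow> 'b" where "lookup \<equiv> Poly_Mapping.lookup"
abbreviation keys :: "('a \<Rightarrow>\<^sub>0 'b::zero) \<Rightarrow> 'a set" where "keys \<equiv> Poly_Mapping.keys"
abbreviation single :: "'a \<Rightarrow> 'b \<Rightarrow> ('a \<Rightarrow>\<^sub>0 'b::zero)" where "single \<equiv> Poly_Mapping.single"

text \<open>Updating a fresh key amounts to adding a \<open>single\<close>, and zero is itself a
  \<open>single\<close>.\<close>

lemma poly_mapping_add_induct [case_names single add]:
  fixes p :: "'a \<Rightarrow>\<^sub>0 'b::comm_monoid_add"
  assumes single: "\<And>m a. P (single m a)" and add: "\<And>p q. P p \<Longrightarrow> P q \<Longrightarrow> P (p + q)"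
  shows "P p"
proof (induction p rule: Poly_Mapping.update_induct)
  case const
  show ?case using single[of _ 0] by simp
next
  case (update p a b)
  have "Poly_Mapping.update a b p = single a b + p"
    using update by (intro poly_mapping_eqI)
      (auto simp: Poly_Mapping.lookup_update lookup_add Poly_Mapping.lookup_single in_keys_iff)
  with update single add show ?case by simp
qed

text \<open>The additive extension of a coefficient map and a monomial map. \<open>msubst\<close>,
  \<open>mpderiv\<close> and \<open>upoly\<close> are all instances, so additivity and
  multiplicativity are proved in one place.\<close>

definition pm_eval :: "('k::comm_ring_1 \<Rightarrow> 'b::comm_ring_1) \<Rightarrow> ('a \<Rightarrow> 'b) \<Rightarrow> ('a \<Rightarrow>\<^sub>0 'k) \<Rightarrow> 'b" where
  "pm_eval c h p = (\<Sum>m\<in>keys p. c (lookup p m) * h m)"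

lemma pm_eval_superset:
  assumes "c 0 = 0" "finite A" "keys p \<subseteq> A"
  shows "pm_eval c h p = (\<Sum>m\<in>A. c (lookup p m) * h m)"
  unfolding pm_eval_def using assms by (intro sum.mono_neutral_left) (auto simp: in_keys_iff)

lemma pm_eval_single: "c 0 = 0 \<Longrightarrow> pm_eval c h (single m a) = c a * h m"
  by (cases "a = 0") (auto simp: pm_eval_def)

lemma pm_eval_add:
  assumes "c 0 = 0" "\<And>a b. c (a + b) = c a + c b"
  shows "pm_eval c h (p + q) = pm_eval c h p + pm_eval c h q"
proof -
  let ?A = "keys p \<union> keys q"
  have "keys (p + q) \<subseteq> ?A" by (rule Poly_Mapping.keys_add)
  then show ?thesis
    by (simp add: pm_eval_superset[where A = ?A] assms lookup_add sum.distrib[symmetric] distrib_right)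
qed

lemma pm_eval_mult:
  assumes c: "c 0 = 0" "\<And>a b. c (a + b) = c a + c b" "\<And>a b. c (a * b) = c a * c b"
    and h: "\<And>m m'. h (m + m') = h m * h m'"
  shows "pm_eval c h (p * q) = pm_eval c h p * pm_eval c h (q :: 'a::comm_monoid_add \<Rightarrow>\<^sub>0 'k::comm_ring_1)"
proof (induction p rule: poly_mapping_add_induct)
  case (single m a)
  show ?case
    by (induction q rule: poly_mapping_add_induct)
      (simp_all add: mult_single pm_eval_single pm_eval_add c h algebra_simps)
next
  case (add p p')
  then show ?case by (simp add: distrib_right pm_eval_add c)
qed

section \<open>Constants, variables and substitution\<close>

lemma mconst_0 [simp]: "mconst 0 = 0"
  and mconst_1 [simp]: "mconst 1 = 1"
  and mconst_add: "mconst (a + b) = mconst a + mconst b"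
  and mconst_mult: "mconst (a * b) = mconst a * (mconst b :: ('v, 'k::comm_ring_1) mpoly)"
  and mconst_mult_single: "mconst a * single m b = single m (a * b)"
  by (simp_all add: mconst_def single_add mult_single)

definition mvar :: "'v \<Rightarrow> ('v, 'k::comm_ring_1) mpoly" where
  "mvar v = single (single v 1) 1"

lemma mvar_power: "mvar v ^ n = single (single v n) 1"
  by (induction n) (simp_all add: mvar_def mult_single flip: single_add)

lemma single_sum_prod:
  "finite A \<Longrightarrow> (\<Prod>v\<in>A. single (f v) (1::'k::comm_ring_1)) = single (\<Sum>v\<in>A. f v :: 'v \<Rightarrow>\<^sub>0 nat) 1"
  by (induction A rule: finite_induct) (simp_all add: mult_single)

lemma sum_single_lookup: "(\<Sum>v\<in>UNIV. single v (lookup m v)) = (m :: 'v::finite \<Rightarrow>\<^sub>0 nat)"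
  by (rule poly_mapping_eqI) (simp add: lookup_sum Poly_Mapping.lookup_single when_def)

lemma single_eq_monomial:
  "single m a = mconst a * (\<Prod>v\<in>UNIV. mvar v ^ lookup (m :: 'v::finite \<Rightarrow>\<^sub>0 nat) v)"
  by (simp add: mvar_power single_sum_prod sum_single_lookup mconst_mult_single)

text \<open>Constants and variables generate the ring. This form suits claims about homomorphisms
  and derivations, while \<open>poly_mapping_add_induct\<close> suits claims about
  coefficients.\<close>

lemma mpoly_ring_induct [case_names const var add mult]:
  fixes p :: "('v::finite, 'k::comm_ring_1) mpoly"
  assumes const: "\<And>c. P (mconst c)" and var: "\<And>v. P (mvar v)"
    and add: "\<And>p q. P p \<Longrightarrow> P q \<Longrightarrow> P (p + q)" and mult: "\<And>p q. P p \<Longrightarrow> P q \<Longrightarrow> P (p * q)"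
  shows "P p"
proof (induction p rule: poly_mapping_add_induct)
  case (single m a)
  have "P 1" using const[of 1] by simp
  then have pow: "P (mvar v ^ n)" for v n by (induction n) (auto intro: var mult)
  have "P (\<Prod>v\<in>A. mvar v ^ lookup m v)" if "finite A" for A
    using that by (induction A rule: finite_induct) (use \<open>P 1\<close> in \<open>auto intro: mult pow\<close>)
  then show ?case by (simp add: single_eq_monomial const mult)
qed (rule add)

context
  fixes F :: "'m::finite \<Rightarrow> ('n, 'k::comm_ring_1) mpoly"
begin

lemma msubst_pm_eval: "msubst w F = pm_eval mconst (\<lambda>m. \<Prod>a\<in>UNIV. F a ^ lookup m a) w"
  by (simp add: msubst_def pm_eval_def)

lemma msubst_add: "msubst (p + q) F = msubst p F + msubst q F"
  by (simp add: msubst_pm_eval pm_eval_add mconst_add)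

lemma msubst_mult: "msubst (p * q) F = msubst p F * msubst q F"
  unfolding msubst_pm_eval
  by (rule pm_eval_mult) (auto simp: mconst_add mconst_mult lookup_add power_add prod.distrib)

lemma msubst_const [simp]: "msubst (mconst c) F = mconst c"
  by (simp add: msubst_pm_eval mconst_def[of c] pm_eval_single)

lemma msubst_0 [simp]: "msubst 0 F = 0" and msubst_1 [simp]: "msubst 1 F = 1"
  using msubst_const[of 0] msubst_const[of 1] by simp_all

lemma msubst_var [simp]: "msubst (mvar v) F = F v"
proof -
  have "(\<Prod>a\<in>UNIV. F a ^ (if v = a then Suc 0 else 0)) = (\<Prod>a\<in>UNIV. if v = a then F a else 1)"
    by (rule prod.cong) auto
  then show ?thesis
    by (simp add: msubst_pm_eval mvar_def pm_eval_single Poly_Mapping.lookup_single when_def del: power_Suc)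
qed

lemma msubst_uminus: "msubst (- p) F = - msubst p F"
  using msubst_add[of p "- p"] by (simp add: eq_neg_iff_add_eq_0 add.commute)

lemma msubst_diff: "msubst (p - q) F = msubst p F - msubst q F"
  using msubst_add[of p "- q"] msubst_uminus by simp

end

lemma msubst_msubst:
  "msubst (msubst p F) G = msubst p (\<lambda>a. msubst (F a) (G :: 'n::finite \<Rightarrow> ('l, 'k::comm_ring_1) mpoly))"
  by (induction p rule: mpoly_ring_induct) (simp_all add: msubst_add msubst_mult)

lemma msubst_mvar [simp]: "msubst p mvar = p"
  by (induction p rule: mpoly_ring_induct) (simp_all add: msubst_add msubst_mult)

section \<open>Formal partial derivatives\<close>

lemma mpderiv_pm_eval:
  "mpderiv j p = pm_eval mconst (\<lambda>m. single (m - single j 1) (of_nat (lookup m j))) (p :: ('v, 'k::comm_ring_1) mpoly)"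
  by (simp add: mpderiv_def pm_eval_def mconst_mult_single mult.commute)

lemma mpderiv_add: "mpderiv j (p + q) = mpderiv j p + mpderiv j (q :: ('v, 'k::comm_ring_1) mpoly)"
  by (simp add: mpderiv_pm_eval pm_eval_add mconst_add)

lemma mpderiv_single:
  "mpderiv j (single m (a::'k::comm_ring_1)) = single (m - single j 1) (of_nat (lookup m j) * a)"
  by (simp add: mpderiv_pm_eval pm_eval_single mconst_mult_single mult.commute)

lemma mpderiv_mult:
  "mpderiv j (p * q) = mpderiv j p * q + p * mpderiv j (q :: ('v, 'k::comm_ring_1) mpoly)"
proof (induction p rule: poly_mapping_add_induct)
  case (single m a)
  show ?case
  proof (induction q rule: poly_mapping_add_induct)
    case (single m' b)
    \<comment> \<open>Exponent subtraction is truncated: it commutes with adding \<open>m2\<close>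
      only if \<open>j\<close> occurs in \<open>m1\<close>, and otherwise the coefficient
      vanishes.\<close>
    have shift: "single (m1 - single j 1 + m2) (of_nat (lookup m1 j) * c) =
        single (m1 + m2 - single j 1) (of_nat (lookup m1 j) * c)" for m1 m2 :: "'v \<Rightarrow>\<^sub>0 nat" and c :: 'k
    proof (cases "lookup m1 j = 0")
      case False
      then have "m1 - single j 1 + m2 = m1 + m2 - single j 1"
        by (intro poly_mapping_eqI) (auto simp: lookup_add lookup_minus Poly_Mapping.lookup_single when_def)
      then show ?thesis by simp
    qed simp
    have "mpderiv j (single m a * single m' b) =
        single (m + m' - single j 1) (of_nat (lookup m j) * (a * b)) +
        single (m' + m - single j 1) (of_nat (lookup m' j) * (a * b))"
      by (simp add: mult_single mpderiv_single lookup_add add.commute distrib_right flip: single_add)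
    also have "\<dots> = single (m - single j 1 + m') (of_nat (lookup m j) * (a * b)) +
        single (m' - single j 1 + m) (of_nat (lookup m' j) * (a * b))"
      by (simp only: shift)
    also have "\<dots> = mpderiv j (single m a) * single m' b + single m a * mpderiv j (single m' b)"
      by (simp add: mult_single mpderiv_single algebra_simps)
    finally show ?case .
  qed (simp add: distrib_left mpderiv_add algebra_simps)
qed (simp add: distrib_right mpderiv_add algebra_simps)

lemma mpderiv_const [simp]: "mpderiv j (mconst (c::'k::comm_ring_1)) = 0"
  by (simp add: mconst_def mpderiv_single)

lemma mpderiv_0 [simp]: "mpderiv j (0 :: ('v, 'k::comm_ring_1) mpoly) = 0"
  and mpderiv_1 [simp]: "mpderiv j (1 :: ('v, 'k::comm_ring_1) mpoly) = 0"
  using mpderiv_const[of j "0::'k"] mpderiv_const[of j "1::'k"] by simp_all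

lemma mpderiv_var: "mpderiv j (mvar v :: ('v, 'k::comm_ring_1) mpoly) = (if j = v then 1 else 0)"
  by (simp add: mvar_def mpderiv_single Poly_Mapping.lookup_single when_def)

lemma mpderiv_uminus: "mpderiv j (- p) = - mpderiv j (p :: ('v, 'k::comm_ring_1) mpoly)"
  using mpderiv_add[of j p "- p"] by (simp add: eq_neg_iff_add_eq_0 add.commute)

lemma mpderiv_diff: "mpderiv j (p - q) = mpderiv j p - mpderiv j (q :: ('v, 'k::comm_ring_1) mpoly)"
  using mpderiv_add[of j p "- q"] by (simp add: mpderiv_uminus)

text \<open>The chain rule. Both sides obey the same sum and product rules in \<open>w\<close>, so
  it suffices to compare them on constants and variables.\<close>

lemma mpderiv_msubst:
  "mpderiv j (msubst w F) = (\<Sum>a\<in>UNIV. msubst (mpderiv a w) F * mpderiv j (F a :: ('n, 'k::comm_ring_1) mpoly))"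
proof (induction w rule: mpoly_ring_induct)
  case (var v)
  have "(\<Sum>a\<in>UNIV. msubst (mpderiv a (mvar v)) F * mpderiv j (F a)) =
      (\<Sum>a\<in>UNIV. if a = v then mpderiv j (F a) else 0)"
    by (intro sum.cong) (auto simp: mpderiv_var)
  then show ?case by simp
next
  case (mult p q)
  then show ?case
    by (simp add: msubst_mult msubst_add mpderiv_mult sum.distrib sum_distrib_left sum_distrib_right distrib_right mult.assoc)
      (simp add: mult.left_commute mult.commute)
qed (simp_all add: msubst_add mpderiv_add sum.distrib distrib_right)

section \<open>Degrees in one variable\<close>

text \<open>With variables indexed by \<open>nat\<close>, monomials carry a linear order compatible
  with addition, so that ring is a domain. \<open>E\<close> embeds the given ring into it by
  renaming variables along an injection into \<open>nat\<close>.\<close>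

lemma mpoly_no_zero_divisors:
  fixes p q :: "('v::finite, 'k::field_char_0) mpoly"
  assumes "p * q = 0"
  shows "p = 0 \<or> q = 0"
proof -
  obtain i :: "'v \<Rightarrow> nat" where i: "inj i"
    using finite_imp_inj_to_nat_seg[of "UNIV :: 'v set"] by auto
  define ren :: "('v \<Rightarrow>\<^sub>0 nat) \<Rightarrow> (nat \<Rightarrow>\<^sub>0 nat)" where
    "ren = (\<lambda>m. \<Sum>v\<in>UNIV. single (i v) (lookup m v))"
  have lookup_ren: "lookup (ren m) (i v) = lookup m v" for m v
    using i by (simp add: ren_def lookup_sum Poly_Mapping.lookup_single when_def inj_eq)
  then have ren_inj: "ren m = ren m' \<longleftrightarrow> m = m'" for m m'
    by (metis poly_mapping_eqI)
  have ren_add: "ren (m + m') = ren m + ren m'" for m m'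
    by (simp add: ren_def lookup_add single_add sum.distrib)
  define E :: "('v, 'k) mpoly \<Rightarrow> (nat \<Rightarrow>\<^sub>0 nat) \<Rightarrow>\<^sub>0 'k" where
    "E = pm_eval (single 0) (\<lambda>m. single (ren m) 1)"
  have "E (p * q) = E p * E q"
    unfolding E_def by (rule pm_eval_mult) (simp_all add: single_add mult_single ren_add)
  moreover have E_lookup: "lookup (E r) (ren m) = lookup r m" for r m
  proof -
    have "lookup (E r) (ren m) = (\<Sum>m'\<in>keys r. if m' = m then lookup r m' else 0)"
      by (simp add: E_def pm_eval_def lookup_sum mult_single Poly_Mapping.lookup_single when_def ren_inj)
    then show ?thesis by (simp add: in_keys_iff)
  qed
  have "E 0 = 0" by (simp add: E_def pm_eval_def)
  ultimately have "E p = 0 \<or> E q = 0" using assms by simp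
  then show ?thesis using E_lookup by (metis lookup_zero poly_mapping_eqI)
qed

lemma mpoly_mult_eq_0 [simp]:
  "p * q = 0 \<longleftrightarrow> p = 0 \<or> q = (0 :: ('v::finite, 'k::field_char_0) mpoly)"
  using mpoly_no_zero_divisors[of p q] by auto

lemma mpoly_mult_cancel_left:
  "p * q = p * r \<longleftrightarrow> p = 0 \<or> q = (r :: ('v::finite, 'k::field_char_0) mpoly)"
  using mpoly_mult_eq_0[of p "q - r"] by (simp add: right_diff_distrib del: mpoly_mult_eq_0)

lemma mpoly_dvd_mult_cancel_left:
  "p \<noteq> 0 \<Longrightarrow> p * q dvd p * r \<longleftrightarrow> q dvd (r :: ('v::finite, 'k::field_char_0) mpoly)"
  by (auto simp: dvd_def mult.assoc mpoly_mult_cancel_left)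

text \<open>The polynomial viewed as a univariate polynomial in the variable t.\<close>

definition upoly :: "'v \<Rightarrow> ('v, 'k::comm_ring_1) mpoly \<Rightarrow> ('v, 'k) mpoly poly" where
  "upoly t = pm_eval (\<lambda>c. [:mconst c:]) (\<lambda>m. monom (single (m - single t (lookup m t)) 1) (lookup m t))"

lemma upoly_add: "upoly t (p + q) = upoly t p + upoly t q"
  by (simp add: upoly_def pm_eval_add mconst_add)

lemma upoly_mult: "upoly t (p * q) = upoly t p * upoly t q"
  unfolding upoly_def
proof (rule pm_eval_mult)
  fix m m' :: "'a \<Rightarrow>\<^sub>0 nat"
  have "m + m' - single t (lookup (m + m') t) = (m - single t (lookup m t)) + (m' - single t (lookup m' t))"
    by (rule poly_mapping_eqI) (simp add: lookup_add lookup_minus Poly_Mapping.lookup_single when_def)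
  then show "monom (single (m + m' - single t (lookup (m + m') t)) (1::'b)) (lookup (m + m') t) =
      monom (single (m - single t (lookup m t)) 1) (lookup m t) *
      monom (single (m' - single t (lookup m' t)) 1) (lookup m' t)"
    by (simp add: mult_monom mult_single lookup_add)
qed (simp_all add: mconst_add mconst_mult)

lemma upoly_single: "upoly t (single m a) = monom (single (m - single t (lookup m t)) a) (lookup m t)"
  by (simp add: upoly_def pm_eval_single smult_monom mconst_mult_single)

lemma upoly_0 [simp]: "upoly t 0 = 0"
  by (simp add: upoly_def pm_eval_def)

lemma upoly_uminus: "upoly t (- p) = - upoly t p"
  using upoly_add[of t p "- p"] by (simp add: eq_neg_iff_add_eq_0 add.commute)

lemma upoly_diff: "upoly t (p - q) = upoly t p - upoly t q"
  using upoly_add[of t p "- q"] upoly_uminus by simp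

lemma upoly_const [simp]: "upoly t (mconst c) = [:mconst c:]"
  by (simp add: mconst_def[of c] upoly_single monom_0)

lemma upoly_var: "upoly t (mvar v) = (if v = t then monom 1 1 else [:mvar v:])"
  by (auto simp: mvar_def upoly_single Poly_Mapping.lookup_single monom_0)

lemma upoly_1 [simp]: "upoly t 1 = 1"
  using upoly_const[of t 1] by (simp add: one_pCons)

lemma upoly_power: "upoly t (p ^ n) = upoly t p ^ n"
  by (induction n) (simp_all add: upoly_mult)

text \<open>Coefficients of \<open>upoly t p\<close> are free of \<open>t\<close>, hence the value 0
  at monomials in which \<open>t\<close> occurs.\<close>

lemma lookup_coeff_upoly:
  "lookup (coeff (upoly t p) i) m = (if lookup m t = 0 then lookup p (m + single t i) else 0)"
proof (induction p rule: poly_mapping_add_induct)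
  case (single m' a)
  have "m' = m + single t i" if "lookup m' t = i" "m' - single t i = m"
    using that by (intro poly_mapping_eqI) (auto simp: lookup_add lookup_minus Poly_Mapping.lookup_single when_def)
  moreover have "lookup m t = 0" if "lookup m' t = i" "m' - single t i = m"
    using that by (auto simp: lookup_minus)
  moreover have "lookup m' t = i \<and> m' - single t i = m" if "lookup m t = 0" "m' = m + single t i"
    using that by (auto simp: lookup_add)
  ultimately have iff: "lookup m' t = i \<and> m' - single t i = m \<longleftrightarrow> lookup m t = 0 \<and> m' = m + single t i"
    by blast
  have "lookup (coeff (upoly t (single m' a)) i) m = (if lookup m' t = i \<and> m' - single t i = m then a else 0)"
    by (simp add: upoly_single Poly_Mapping.lookup_single when_def)
  also have "\<dots> = (if lookup m t = 0 then lookup (single m' a) (m + single t i) else 0)"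
    unfolding iff by (simp add: Poly_Mapping.lookup_single when_def)
  finally show ?case .
qed (simp add: upoly_add lookup_add)

text \<open>Substituting \<open>t\<close> back for the univariate indeterminate inverts
  \<open>upoly t\<close>, which is therefore injective.\<close>

lemma poly_upoly [simp]: "poly (upoly t p) (mvar t) = (p :: ('v::finite, 'k::comm_ring_1) mpoly)"
  by (induction p rule: mpoly_ring_induct) (simp_all add: upoly_add upoly_mult upoly_var poly_monom)

lemma upoly_inj [simp]: "upoly t p = upoly t q \<longleftrightarrow> p = (q :: ('v::finite, 'k::comm_ring_1) mpoly)"
  by (metis poly_upoly)

lemma upoly_eq_0 [simp]: "upoly t p = 0 \<longleftrightarrow> p = (0 :: ('v::finite, 'k::comm_ring_1) mpoly)"
  using upoly_inj[of t p 0] by (simp del: upoly_inj)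

text \<open>The zero polynomial gets degree 0, which is why later degree comparisons treat it as a
  separate case.\<close>

definition mdeg :: "'v \<Rightarrow> ('v, 'k::comm_ring_1) mpoly \<Rightarrow> nat" where
  "mdeg t p = degree (upoly t p)"

text \<open>Kept in the ring of \<open>p\<close> although free of \<open>t\<close>, so that
  pseudo-division needs no change of type.\<close>

definition lcf :: "'v \<Rightarrow> ('v, 'k::comm_ring_1) mpoly \<Rightarrow> ('v, 'k) mpoly" where
  "lcf t p = lead_coeff (upoly t p)"

lemma lcf_0 [simp]: "lcf t 0 = 0"
  by (simp add: lcf_def)

lemma mdeg_le_iff: "mdeg t p \<le> n \<longleftrightarrow> (\<forall>m\<in>keys p. lookup m t \<le> n)"
proof
  assume n: "mdeg t p \<le> n"
  show "\<forall>m\<in>keys p. lookup m t \<le> n"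
  proof
    fix m assume m: "m \<in> keys p"
    have "m = m - single t (lookup m t) + single t (lookup m t)"
      by (rule poly_mapping_eqI) (simp add: lookup_add lookup_minus Poly_Mapping.lookup_single when_def)
    then have "lookup (coeff (upoly t p) (lookup m t)) (m - single t (lookup m t)) = lookup p m"
      by (simp add: lookup_coeff_upoly lookup_minus)
    then have "coeff (upoly t p) (lookup m t) \<noteq> 0" using m by (auto simp: in_keys_iff)
    then show "lookup m t \<le> n" using n le_degree unfolding mdeg_def by (metis le_trans)
  qed
next
  assume n: "\<forall>m\<in>keys p. lookup m t \<le> n"
  show "mdeg t p \<le> n" unfolding mdeg_def
  proof (rule degree_le, intro allI impI)
    fix i assume "n < i"
    have "lookup p (m + single t i) = 0" if "lookup m t = 0" for m
    proof (rule ccontr)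
      assume "lookup p (m + single t i) \<noteq> 0"
      then have "lookup (m + single t i) t \<le> n" using n by (simp add: in_keys_iff)
      with that \<open>n < i\<close> show False by (simp add: lookup_add)
    qed
    then have "lookup (coeff (upoly t p) i) m = 0" for m
      by (simp add: lookup_coeff_upoly)
    then show "coeff (upoly t p) i = 0" by (intro poly_mapping_eqI) simp
  qed
qed

lemma mdeg_0 [simp]: "mdeg t 0 = 0" by (simp add: mdeg_def)
lemma mdeg_const [simp]: "mdeg t (mconst c) = 0" by (simp add: mdeg_def)
lemma mdeg_1 [simp]: "mdeg t 1 = 0" using mdeg_const[of t 1] by simp
lemma mdeg_var: "mdeg t (mvar v :: ('v, 'k::comm_ring_1) mpoly) = (if t = v then 1 else 0)"
  by (auto simp: mdeg_def upoly_var degree_monom_eq)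

lemma mdeg_add_le: "mdeg t p \<le> n \<Longrightarrow> mdeg t q \<le> n \<Longrightarrow> mdeg t (p + q) \<le> n"
  unfolding mdeg_def upoly_add by (rule degree_add_le)

lemma mdeg_diff_le: "mdeg t p \<le> n \<Longrightarrow> mdeg t q \<le> n \<Longrightarrow> mdeg t (p - q) \<le> n"
  unfolding mdeg_def upoly_diff by (rule degree_diff_le)

lemma mdeg_coeff_le: "mdeg v (coeff (upoly t p) i) \<le> mdeg v p"
  unfolding mdeg_le_iff
proof
  fix m assume "m \<in> keys (coeff (upoly t p) i)"
  then have "m + single t i \<in> keys p" by (auto simp: in_keys_iff lookup_coeff_upoly split: if_splits)
  then have "lookup (m + single t i) v \<le> mdeg v p" using mdeg_le_iff[of v p "mdeg v p"] by simp
  then show "lookup m v \<le> mdeg v p" by (simp add: lookup_add)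
qed

lemma mdeg_coeff_self [simp]: "mdeg t (coeff (upoly t p) i) = 0"
proof -
  have "mdeg t (coeff (upoly t p) i) \<le> 0"
    unfolding mdeg_le_iff by (auto simp: in_keys_iff lookup_coeff_upoly split: if_splits)
  then show ?thesis by simp
qed

lemma mdeg_eq_0_imp: "mdeg t p = 0 \<Longrightarrow> upoly t p = [:p:]" for p :: "('v::finite, 'k::comm_ring_1) mpoly"
proof -
  assume "mdeg t p = 0"
  then obtain c where c: "upoly t p = [:c:]" unfolding mdeg_def by (rule degree_eq_zeroE)
  have "p = poly [:c:] (mvar t)" unfolding c[symmetric] by simp
  with c show ?thesis by simp
qed

lemma all_mdeg_0_const:
  fixes p :: "('v::finite, 'k::comm_ring_1) mpoly"
  assumes "\<And>v. mdeg v p = 0"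
  shows "\<exists>c. p = mconst c"
proof
  have "lookup m v = 0" if "m \<in> keys p" for m v
    using mdeg_le_iff[of v p 0] assms that by simp
  then have "lookup p m = 0" if "m \<noteq> 0" for m
    using that by (metis in_keys_iff lookup_zero poly_mapping_eqI)
  then show "p = mconst (lookup p 0)"
    by (intro poly_mapping_eqI) (auto simp: mconst_def Poly_Mapping.lookup_single when_def)
qed

lemma lcf_eq_0 [simp]: "lcf t p = 0 \<longleftrightarrow> p = (0 :: ('v::finite, 'k::comm_ring_1) mpoly)"
  by (simp add: lcf_def)

lemma mdeg_lcf [simp]: "mdeg t (lcf t p) = 0"
  by (simp add: lcf_def)

lemma
  fixes p q :: "('v::finite, 'k::field_char_0) mpoly"
  assumes "p \<noteq> 0" "q \<noteq> 0"
  shows mdeg_mult: "mdeg t (p * q) = mdeg t p + mdeg t q"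
    and lcf_mult: "lcf t (p * q) = lcf t p * lcf t q"
proof -
  let ?n = "degree (upoly t p) + degree (upoly t q)"
  have c: "coeff (upoly t p * upoly t q) ?n = lcf t p * lcf t q"
    by (simp add: coeff_mult_degree_sum lcf_def)
  then have "coeff (upoly t p * upoly t q) ?n \<noteq> 0" using assms by simp
  then have d: "degree (upoly t p * upoly t q) = ?n"
    by (meson degree_mult_le le_antisym le_degree)
  then show "mdeg t (p * q) = mdeg t p + mdeg t q" by (simp add: mdeg_def upoly_mult)
  show "lcf t (p * q) = lcf t p * lcf t q" using c d by (simp add: lcf_def upoly_mult)
qed

lemma mdeg_power: "p \<noteq> 0 \<Longrightarrow> mdeg t (p ^ n) = n * mdeg t (p :: ('v::finite, 'k::field_char_0) mpoly)"
  and power_ne_0: "p \<noteq> 0 \<Longrightarrow> p ^ n \<noteq> (0 :: ('v::finite, 'k::field_char_0) mpoly)"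
proof -
  have "p \<noteq> 0 \<Longrightarrow> p ^ n \<noteq> 0 \<and> mdeg t (p ^ n) = n * mdeg t p"
    by (induction n) (auto simp: mdeg_mult)
  then show "p \<noteq> 0 \<Longrightarrow> mdeg t (p ^ n) = n * mdeg t p" "p \<noteq> 0 \<Longrightarrow> p ^ n \<noteq> 0" by auto
qed

lemma mvar_ne_0 [simp]: "mvar v \<noteq> (0 :: ('v, 'k::field_char_0) mpoly)"
  by (metis lookup_single_eq lookup_zero mvar_def zero_neq_one)

lemma lcf_power_var [simp]: "lcf t (mvar t ^ n :: ('v, 'k::field_char_0) mpoly) = 1"
  by (simp add: lcf_def upoly_power upoly_var monom_power degree_monom_eq)

lemma lcf_mdeg_0: "mdeg t p = 0 \<Longrightarrow> lcf t p = (p :: ('v::finite, 'k::comm_ring_1) mpoly)"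
  by (simp add: mdeg_eq_0_imp lcf_def)

text \<open>Equal leading terms cancel. The degree has to be positive because a vanishing difference
  still has degree 0.\<close>

lemma mdeg_diff_less:
  assumes "mdeg t p = mdeg t q" "lcf t p = lcf t q" "0 < mdeg t p"
  shows "mdeg t (p - q) < mdeg t p"
proof -
  let ?d = "degree (upoly t p)"
  have "degree (upoly t p - upoly t q) \<le> ?d" "coeff (upoly t p - upoly t q) ?d = 0"
    using assms by (auto simp: mdeg_def lcf_def intro: degree_diff_le)
  then show ?thesis
    using eq_zero_or_degree_less assms(3) unfolding mdeg_def upoly_diff by fastforce
qed

section \<open>Degrees of partial derivatives\<close>

lemma lookup_mconst_mult: "lookup (mconst c * p) m = (c :: 'k::comm_ring_1) * lookup p m"
  by (induction p rule: poly_mapping_add_induct)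
    (simp_all add: mconst_mult_single lookup_add distrib_left Poly_Mapping.lookup_single when_def)

lemma lookup_mpderiv:
  "lookup (mpderiv j p) m = of_nat (Suc (lookup m j)) * lookup (p :: ('v, 'k::comm_ring_1) mpoly) (m + single j 1)"
proof (induction p rule: poly_mapping_add_induct)
  case (single m' a)
  have "m' = m + single j 1" if "lookup m' j \<noteq> 0" "m' - single j 1 = m"
    using that by (intro poly_mapping_eqI) (auto simp: lookup_add lookup_minus Poly_Mapping.lookup_single when_def)
  moreover have "m' - single j 1 = m" "lookup m' j = Suc (lookup m j)" if "m' = m + single j 1"
    using that by (auto simp: lookup_add)
  ultimately have iff: "lookup m' j \<noteq> 0 \<and> m' - single j 1 = m \<longleftrightarrow> m' = m + single j 1"
    by (metis nat.distinct(1))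
  have "lookup (mpderiv j (single m' a)) m =
      (if lookup m' j \<noteq> 0 \<and> m' - single j 1 = m then of_nat (lookup m' j) * a else 0)"
    by (simp add: mpderiv_single Poly_Mapping.lookup_single when_def)
  also have "\<dots> = of_nat (Suc (lookup m j)) * lookup (single m' a) (m + single j 1)"
    unfolding iff by (simp add: Poly_Mapping.lookup_single when_def lookup_add)
  finally show ?case .
qed (simp add: mpderiv_add lookup_add algebra_simps)

lemma coeff_upoly_mpderiv:
  "coeff (upoly t (mpderiv t p)) i = mconst (of_nat (Suc i)) * coeff (upoly t (p :: ('v, 'k::comm_ring_1) mpoly)) (Suc i)"
proof (rule poly_mapping_eqI)
  fix m
  have "m + single t i + single t (Suc 0) = m + single t (Suc i)"
    by (simp add: add.assoc flip: single_add)
  then show "lookup (coeff (upoly t (mpderiv t p)) i) m =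
      lookup (mconst (of_nat (Suc i)) * coeff (upoly t p) (Suc i)) m"
    by (auto simp: lookup_mconst_mult lookup_coeff_upoly lookup_mpderiv lookup_add)
qed

lemma mconst_eq_0 [simp]: "mconst c = 0 \<longleftrightarrow> c = 0"
  by (metis lookup_single_eq lookup_zero mconst_0 mconst_def)

lemma mconst_unit: "c \<noteq> 0 \<Longrightarrow> mconst (c :: 'k::field_char_0) dvd 1"
  by (rule dvdI[of _ _ "mconst (inverse c)"]) (simp flip: mconst_mult)

lemma mpderiv_mdeg_0: "mdeg t p = 0 \<Longrightarrow> mpderiv t p = 0"
  for p :: "('v::finite, 'k::comm_ring_1) mpoly"
  by (rule upoly_inj[of t, THEN iffD1], rule poly_eqI)
    (simp add: coeff_upoly_mpderiv mdeg_def coeff_eq_0)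

lemma mdeg_mpderiv_le: "mdeg v (mpderiv t p) \<le> mdeg v (p :: ('v, 'k::comm_ring_1) mpoly)"
  unfolding mdeg_le_iff
proof
  fix m assume "m \<in> keys (mpderiv t p)"
  then have "lookup p (m + single t 1) \<noteq> 0"
    unfolding in_keys_iff lookup_mpderiv by (metis mult_zero_right)
  then have "lookup (m + single t 1) v \<le> mdeg v p"
    using mdeg_le_iff[of v p "mdeg v p"] by (simp add: in_keys_iff)
  then show "lookup m v \<le> mdeg v p" by (simp add: lookup_add)
qed

text \<open>Characteristic zero enters here: the factor \<open>of_nat (mdeg t p)\<close> that
  differentiation puts on the leading coefficient is nonzero.\<close>

lemma
  fixes p :: "('v::finite, 'k::field_char_0) mpoly"
  assumes "0 < mdeg t p"
  shows mdeg_mpderiv_less: "mdeg t (mpderiv t p) < mdeg t p"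
    and lcf_mpderiv: "lcf t (mpderiv t p) = mconst (of_nat (mdeg t p)) * lcf t p"
    and mpderiv_ne_0: "mpderiv t p \<noteq> 0"
proof -
  obtain d where d: "mdeg t p = Suc d" using assms by (cases "mdeg t p") auto
  have c: "coeff (upoly t (mpderiv t p)) d = mconst (of_nat (mdeg t p)) * lcf t p"
    by (simp add: coeff_upoly_mpderiv lcf_def mdeg_def flip: d)
  have le: "degree (upoly t (mpderiv t p)) \<le> d"
    by (rule degree_le) (use d in \<open>auto simp: coeff_upoly_mpderiv mdeg_def coeff_eq_0\<close>)
  have "p \<noteq> 0" using assms by auto
  then have "coeff (upoly t (mpderiv t p)) d \<noteq> 0" using assms by (simp add: c)
  with le have "degree (upoly t (mpderiv t p)) = d" by (metis le_antisym le_degree)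
  then show "mdeg t (mpderiv t p) < mdeg t p" "lcf t (mpderiv t p) = mconst (of_nat (mdeg t p)) * lcf t p"
    using c d by (simp_all add: mdeg_def lcf_def)
  then show "mpderiv t p \<noteq> 0" using \<open>p \<noteq> 0\<close> assms by (metis lcf_eq_0 mconst_eq_0 mpoly_mult_eq_0 of_nat_eq_0_iff less_irrefl)
qed

section \<open>Unique factorisation\<close>

text \<open>The subring generated over \<open>k\<close> by the variables in \<open>S\<close>.
  Describing it by vanishing degrees, not by a type of its own, lets \<open>S\<close> grow in
  inductions.\<close>

definition psub :: "'v set \<Rightarrow> ('v, 'k::comm_ring_1) mpoly set" where
  "psub S = {p. \<forall>v. v \<notin> S \<longrightarrow> mdeg v p = 0}"

lemma psub_UNIV [simp]: "psub UNIV = UNIV" by (simp add: psub_def)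

lemma psub_mono: "S \<subseteq> T \<Longrightarrow> p \<in> psub S \<Longrightarrow> p \<in> psub T"
  by (auto simp: psub_def)

lemma psub_0 [simp]: "0 \<in> psub S" by (simp add: psub_def)
lemma psub_1 [simp]: "1 \<in> psub S" by (simp add: psub_def)
lemma psub_var: "v \<in> S \<Longrightarrow> mvar v \<in> psub S" by (auto simp: psub_def mdeg_var)

lemma psub_add: "p \<in> psub S \<Longrightarrow> q \<in> psub S \<Longrightarrow> p + q \<in> psub S"
  using mdeg_add_le[of _ p 0 q] by (auto simp: psub_def)

lemma psub_diff: "p \<in> psub S \<Longrightarrow> q \<in> psub S \<Longrightarrow> p - q \<in> psub S"
  using mdeg_diff_le[of _ p 0 q] by (auto simp: psub_def)

lemma psub_mult: "p \<in> psub S \<Longrightarrow> q \<in> psub S \<Longrightarrow> p * q \<in> psub S"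
  for p q :: "('v::finite, 'k::field_char_0) mpoly"
  by (cases "p = 0 \<or> q = 0") (auto simp: psub_def mdeg_mult)

lemma psub_power: "p \<in> psub S \<Longrightarrow> p ^ n \<in> psub S"
  for p :: "('v::finite, 'k::field_char_0) mpoly"
  by (induction n) (auto intro: psub_mult)

text \<open>Degrees in each variable add up in a nonzero product, so these subrings are closed under
  taking factors.\<close>

lemma psub_factor:
  fixes p q :: "('v::finite, 'k::field_char_0) mpoly"
  assumes "p * q \<in> psub S" "p * q \<noteq> 0"
  shows "p \<in> psub S" "q \<in> psub S"
  using assms by (auto simp: psub_def mdeg_mult)

lemma psub_coeff: "p \<in> psub (insert t S) \<Longrightarrow> coeff (upoly t p) i \<in> psub S"
proof -
  assume p: "p \<in> psub (insert t S)"
  have "mdeg v (coeff (upoly t p) i) = 0" if "v \<notin> S" for v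
    using p that mdeg_coeff_le[of v t p i] by (cases "v = t") (auto simp: psub_def)
  then show ?thesis by (simp add: psub_def)
qed

lemma psub_lcf: "p \<in> psub (insert t S) \<Longrightarrow> lcf t p \<in> psub S"
  by (simp add: lcf_def psub_coeff)

lemma psub_mpderiv: "p \<in> psub S \<Longrightarrow> mpderiv t p \<in> psub S"
proof -
  assume p: "p \<in> psub S"
  have "mdeg v (mpderiv t p) = 0" if "v \<notin> S" for v
    using p that mdeg_mpderiv_le[of v t p] by (simp add: psub_def)
  then show ?thesis by (simp add: psub_def)
qed

lemma psub_insert_mdeg_0: "p \<in> psub (insert t S) \<Longrightarrow> mdeg t p = 0 \<Longrightarrow> p \<in> psub S"
proof -
  assume p: "p \<in> psub (insert t S)" "mdeg t p = 0"
  have "mdeg v p = 0" if "v \<notin> S" for v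
    using p that by (cases "v = t") (auto simp: psub_def)
  then show ?thesis by (simp add: psub_def)
qed

lemma mdeg_psub: "p \<in> psub S \<Longrightarrow> t \<notin> S \<Longrightarrow> mdeg t p = 0"
  by (auto simp: psub_def)

text \<open>The sum of the degrees in the single variables, which may exceed the total degree. It is
  additive on nonzero products and vanishes exactly on constants, so it serves as the measure for
  factorisations.\<close>

definition tdeg :: "('v::finite, 'k::comm_ring_1) mpoly \<Rightarrow> nat" where
  "tdeg p = (\<Sum>v\<in>UNIV. mdeg v p)"

lemma tdeg_mult: "p \<noteq> 0 \<Longrightarrow> q \<noteq> 0 \<Longrightarrow> tdeg (p * q) = tdeg p + tdeg q"
  for p q :: "('v::finite, 'k::field_char_0) mpoly"
  by (simp add: tdeg_def mdeg_mult sum.distrib)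

lemma mpoly_unit_iff: "p dvd 1 \<longleftrightarrow> p \<noteq> 0 \<and> tdeg p = 0"
  for p :: "('v::finite, 'k::field_char_0) mpoly"
proof
  assume "p dvd 1"
  then obtain q where q: "1 = p * q" by (elim dvdE)
  then have "p \<noteq> 0" "q \<noteq> 0" by (metis mult_zero_left mult_zero_right zero_neq_one)+
  then have "tdeg p + tdeg q = tdeg (1 :: ('v, 'k) mpoly)" using tdeg_mult q by metis
  then show "p \<noteq> 0 \<and> tdeg p = 0" using \<open>p \<noteq> 0\<close> by (simp add: tdeg_def)
next
  assume p: "p \<noteq> 0 \<and> tdeg p = 0"
  then obtain c where "p = mconst c" using all_mdeg_0_const[of p] by (auto simp: tdeg_def)
  with p show "p dvd 1" by (simp add: mconst_unit)
qed

lemma mdeg_unit: "p dvd 1 \<Longrightarrow> mdeg t p = 0"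
  for p :: "('v::finite, 'k::field_char_0) mpoly"
  by (simp add: mpoly_unit_iff tdeg_def)

section \<open>Irreducible factors and pseudo-division\<close>

lemma mpoly_irreducible_factor:
  fixes p :: "('v::finite, 'k::field_char_0) mpoly"
  assumes "p \<noteq> 0" "\<not> p dvd 1"
  shows "\<exists>q. irreducible q \<and> q dvd p"
  using assms
proof (induction "tdeg p" arbitrary: p rule: less_induct)
  case less
  show ?case
  proof (cases "irreducible p")
    case False
    with less.prems obtain a b where ab: "p = a * b" "\<not> a dvd 1" "\<not> b dvd 1"
      by (auto simp: irreducible_def)
    then have "a \<noteq> 0" "b \<noteq> 0" using less.prems by auto
    with ab have "tdeg a < tdeg p" by (auto simp: tdeg_mult mpoly_unit_iff)
    then obtain q where "irreducible q" "q dvd a" using less.hyps[of a] \<open>a \<noteq> 0\<close> ab by auto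
    then show ?thesis using ab by (auto intro: dvd_mult2)
  qed auto
qed

lemma exists_irreducible_dvd:
  fixes p :: "('v::finite, 'k::field_char_0) mpoly"
  assumes "\<not> p dvd 1"
  shows "\<exists>q. irreducible q \<and> q dvd p"
proof (cases "p = 0")
  case True
  \<comment> \<open>Everything divides 0, so any irreducible element will do; an arbitrary variable
    is a nonzero nonunit and supplies one.\<close>
  have "\<not> (mvar undefined :: ('v, 'k) mpoly) dvd 1"
    using mdeg_unit[of "mvar undefined :: ('v, 'k) mpoly" undefined] by (auto simp: mdeg_var)
  then show ?thesis using mpoly_irreducible_factor[of "mvar undefined :: ('v, 'k) mpoly"] True by auto
qed (use assms mpoly_irreducible_factor in blast)

text \<open>One step of pseudo-division: multiplying by \<open>lcf t d\<close> replaces a division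
  by it and makes the leading terms cancel.\<close>

lemma pseudo_reduce:
  fixes u d :: "('v::finite, 'k::field_char_0) mpoly"
  assumes "u \<noteq> 0" "d \<noteq> 0" "mdeg t d \<le> mdeg t u"
  defines "u' \<equiv> lcf t d * u - lcf t u * mvar t ^ (mdeg t u - mdeg t d) * d"
  shows "u' = 0 \<or> mdeg t u' < mdeg t u"
proof (cases "mdeg t u = 0")
  case True
  then show ?thesis using assms by (simp add: lcf_mdeg_0 mult.commute)
next
  case False
  have "lcf t u * mvar t ^ (mdeg t u - mdeg t d) \<noteq> 0"
    using assms by (simp add: power_ne_0)
  then have "mdeg t (lcf t u * mvar t ^ (mdeg t u - mdeg t d) * d) = mdeg t u"
    "lcf t (lcf t u * mvar t ^ (mdeg t u - mdeg t d) * d) = lcf t u * lcf t d"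
    using assms by (simp_all add: mdeg_mult lcf_mult mdeg_power mdeg_var power_ne_0 lcf_mdeg_0)
  moreover have "mdeg t (lcf t d * u) = mdeg t u" "lcf t (lcf t d * u) = lcf t d * lcf t u"
    using assms by (simp_all add: mdeg_mult lcf_mult lcf_mdeg_0)
  ultimately show ?thesis
    using mdeg_diff_less[of t "lcf t d * u" "lcf t u * mvar t ^ (mdeg t u - mdeg t d) * d"] False
    by (simp add: u'_def mult.commute[of "lcf t d" "lcf t u"])
qed

lemma mdeg_drop_lcf:
  fixes g :: "('v::finite, 'k::field_char_0) mpoly"
  assumes "0 < mdeg t g"
  shows "mdeg t (g - lcf t g * mvar t ^ mdeg t g) < mdeg t g"
proof -
  have "g \<noteq> 0" using assms by auto
  then have "lcf t g \<noteq> 0" by simp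
  then show ?thesis
    using assms by (intro mdeg_diff_less)
      (simp_all add: mdeg_mult lcf_mult mdeg_power mdeg_var power_ne_0 lcf_mdeg_0)
qed

text \<open>Pseudo-division by \<open>d\<close> stays in the ideal \<open>I\<close> and by
  minimality ends at 0. The factor \<open>c\<close> collects the leading coefficients used on the
  way; over the fraction field of \<open>psub S\<close> it would be an invertible
  denominator.\<close>

lemma min_mdeg_dvd:
  fixes d u :: "('v::finite, 'k::field_char_0) mpoly"
  assumes t: "t \<notin> S" and I: "I \<subseteq> psub (insert t S)"
    and diff: "\<And>u v. u \<in> I \<Longrightarrow> v \<in> I \<Longrightarrow> u - v \<in> I"
    and mult: "\<And>a u. a \<in> psub (insert t S) \<Longrightarrow> u \<in> I \<Longrightarrow> a * u \<in> I"
    and d: "d \<in> I" "d \<noteq> 0" and min: "\<And>u. u \<in> I \<Longrightarrow> u \<noteq> 0 \<Longrightarrow> mdeg t d \<le> mdeg t u"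
    and u: "u \<in> I"
  shows "\<exists>c\<in>psub S. c \<noteq> 0 \<and> d dvd c * u"
  using u
proof (induction "mdeg t u" arbitrary: u rule: less_induct)
  case less
  show ?case
  proof (cases "u = 0")
    case True
    then show ?thesis by (intro bexI[of _ 1]) auto
  next
    case False
    define w where "w = lcf t u * mvar t ^ (mdeg t u - mdeg t d)"
    define u' where "u' = lcf t d * u - w * d"
    have lcf_in: "lcf t d \<in> psub S" "lcf t u \<in> psub S"
      using d less.prems I by (auto intro: psub_lcf)
    then have "lcf t d \<in> psub (insert t S)" "w \<in> psub (insert t S)"
      by (auto simp: w_def intro!: psub_mult psub_power psub_var intro: psub_mono[of S])
    then have "u' \<in> I" unfolding u'_def using d less.prems diff mult by blast
    moreover have "u' = 0 \<or> mdeg t u' < mdeg t u"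
      unfolding u'_def w_def using pseudo_reduce False d min less.prems by blast
    ultimately obtain c where c: "c \<in> psub S" "c \<noteq> 0" "d dvd c * u'"
      using less.hyps[of u'] by (metis dvd_0_right mult_zero_right psub_1 zero_neq_one)
    have "d dvd c * u' + c * (w * d)" using c by simp
    also have "c * u' + c * (w * d) = c * lcf t d * u" by (simp add: u'_def algebra_simps)
    finally show ?thesis using c lcf_in d by (intro bexI[of _ "c * lcf t d"]) (auto intro: psub_mult)
  qed
qed

section \<open>Gauss's lemma\<close>

lemma dvd_lcf:
  fixes c p :: "('v::finite, 'k::field_char_0) mpoly"
  assumes "c dvd p" "mdeg t c = 0"
  shows "c dvd lcf t p"
proof (cases "p = 0")
  case False
  with assms obtain q where "p = c * q" "c \<noteq> 0" "q \<noteq> 0" by (auto elim!: dvdE)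
  then show ?thesis using assms by (simp add: lcf_mult lcf_mdeg_0)
qed (simp add: lcf_def)

text \<open>Primality tested on factors from \<open>psub S\<close> only; this relative form carries
  the induction over sets of variables.\<close>

definition prime_in :: "'v set \<Rightarrow> ('v::finite, 'k::field_char_0) mpoly \<Rightarrow> bool" where
  "prime_in S p \<longleftrightarrow> (\<forall>a\<in>psub S. \<forall>b\<in>psub S. p dvd a * b \<longrightarrow> p dvd a \<or> p dvd b)"

text \<open>If \<open>c\<close> divides \<open>g * h\<close>, it divides the product of the leading
  coefficients and hence one of them. Dropping that leading term keeps the divisibility and lowers
  the sum of the degrees.\<close>

lemma prime_in_insert:
  assumes t: "t \<notin> S" and c: "c \<in> psub S" "prime_in S c"
  shows "prime_in (insert t S) c"
proof -
  have c0: "mdeg t c = 0" using c t by (auto simp: psub_def)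
  have "c dvd g \<or> c dvd h" if "g \<in> psub (insert t S)" "h \<in> psub (insert t S)" "c dvd g * h" for g h
    using that
  proof (induction "mdeg t g + mdeg t h" arbitrary: g h rule: less_induct)
    case less
    \<comment> \<open>Formulated for \<open>a\<close> and \<open>b\<close> because it is applied to
      \<open>g\<close> and \<open>h\<close> in both orders.\<close>
    have *: "c dvd a \<or> c dvd b" if "mdeg t a + mdeg t b = mdeg t g + mdeg t h"
      "a \<in> psub (insert t S)" "b \<in> psub (insert t S)" "c dvd a * b" "c dvd lcf t a" for a b
    proof (cases "mdeg t a = 0")
      case True
      then show ?thesis using that by (simp add: lcf_mdeg_0)
    next
      case False
      let ?w = "lcf t a * mvar t ^ mdeg t a"
      let ?a = "a - ?w"
      have "?a \<in> psub (insert t S)" using that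
        by (intro psub_diff psub_mult psub_power psub_var) (auto intro: psub_mono[of S] psub_lcf)
      moreover have "mdeg t ?a + mdeg t b < mdeg t g + mdeg t h"
        using mdeg_drop_lcf[of t a] False that by simp
      moreover have "c dvd ?a * b" using that by (simp add: left_diff_distrib)
      ultimately have "c dvd ?a \<or> c dvd b" using less.hyps that(3) by blast
      moreover have "c dvd ?w" using that by simp
      ultimately show ?thesis by (metis diff_add_cancel dvd_add)
    qed
    show ?case
    proof (cases "g = 0 \<or> h = 0")
      case False
      then have "c dvd lcf t g * lcf t h" using dvd_lcf[OF less.prems(3) c0] by (simp add: lcf_mult)
      then have "c dvd lcf t g \<or> c dvd lcf t h"
        using c less.prems unfolding prime_in_def by (blast intro: psub_lcf)
      then show ?thesis using *[of g h] *[of h g] less.prems by (auto simp: mult.commute add.commute)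
    qed auto
  qed
  then show ?thesis by (auto simp: prime_in_def)
qed

text \<open>The cofactor \<open>z\<close> is a unit and has degree 0 in every variable.\<close>

lemma irreducible_assoc:
  assumes "irreducible p" "p = c * z" "\<not> c dvd 1" "mdeg t c = 0"
  shows "mdeg t (p :: ('v::finite, 'k::field_char_0) mpoly) = 0"
proof -
  have "z dvd 1" "c \<noteq> 0" "z \<noteq> 0" using assms by (auto simp: irreducible_def)
  then show ?thesis using assms mdeg_unit[of z t] by (simp add: mdeg_mult)
qed

section \<open>The induction step of unique factorisation: adjoining one variable\<close>

context
  fixes S :: "'v::finite set" and t :: 'v
  assumes t: "t \<notin> S"
    and prime_S: "\<And>c :: ('v, 'k::field_char_0) mpoly. c \<in> psub S \<Longrightarrow> irreducible c \<Longrightarrow> prime_in S c"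
begin

text \<open>Splits off one irreducible factor, prime also after adjoining \<open>t\<close>. The next
  two lemmas remove a denominator \<open>c\<close> factor by factor in this way.\<close>

lemma psub_split_prime:
  fixes c :: "('v, 'k) mpoly"
  assumes "c \<in> psub S" "c \<noteq> 0" "\<not> c dvd 1"
  obtains c1 c2 where "c = c1 * c2" "c1 \<in> psub S" "c2 \<in> psub S" "c1 \<noteq> 0" "c2 \<noteq> 0" "\<not> c1 dvd 1"
    "mdeg t c1 = 0" "prime_in (insert t S) c1" "tdeg c2 < tdeg c"
proof -
  obtain c1 where c1: "irreducible c1" "c1 dvd c" using mpoly_irreducible_factor assms by blast
  then obtain c2 where c: "c = c1 * c2" by (elim dvdE)
  have n0: "c1 \<noteq> 0" "c2 \<noteq> 0" using c assms by auto
  have c12: "c1 \<in> psub S" "c2 \<in> psub S" using psub_factor[of c1 c2 S] c assms by auto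
  have "\<not> c1 dvd 1" using c1 by (simp add: irreducible_def)
  then have td: "tdeg c2 < tdeg c" using c n0 by (simp add: tdeg_mult mpoly_unit_iff)
  have pr: "prime_in (insert t S) c1" by (intro prime_in_insert[OF t] prime_S c12 c1)
  have deg: "mdeg t c1 = 0" by (rule mdeg_psub[OF c12(1) t])
  show thesis by (rule that[OF c c12 n0 \<open>\<not> c1 dvd 1\<close> deg pr td])
qed

text \<open>In \<open>c1 * (c2 * h) = p * s\<close> the prime \<open>c1\<close> cannot divide
  \<open>p\<close>, which is irreducible of positive degree in \<open>t\<close>. So it divides
  \<open>s\<close> and cancels.\<close>

lemma irreducible_dvd_cancel:
  fixes p c h :: "('v, 'k) mpoly"
  assumes p: "irreducible p" "p \<in> psub (insert t S)" "0 < mdeg t p"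
    and c: "c \<in> psub S" "c \<noteq> 0" and h: "h \<in> psub (insert t S)" and dvd: "p dvd c * h"
  shows "p dvd h"
  using c dvd
proof (induction "tdeg c" arbitrary: c rule: less_induct)
  case less
  show ?case
  proof (cases "c dvd 1")
    case True
    then obtain e where e: "1 = c * e" by (elim dvdE)
    have "p dvd c * h * e" using less.prems by simp
    also have "c * h * e = h" by (metis e mult.commute mult.left_commute mult_1_right)
    finally show ?thesis .
  next
    case False
    then obtain c1 c2 where c: "c = c1 * c2" "c1 \<in> psub S" "c2 \<in> psub S" "c1 \<noteq> 0" "c2 \<noteq> 0"
      "\<not> c1 dvd 1" "mdeg t c1 = 0" "prime_in (insert t S) c1" "tdeg c2 < tdeg c"
      using psub_split_prime less.prems by metis
    obtain s where s: "c1 * (c2 * h) = p * s" using less.prems c by (auto elim!: dvdE simp: mult.assoc)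
    have "\<not> c1 dvd p" using irreducible_assoc[of p c1 _ t] p c by (auto elim!: dvdE)
    have "p dvd c2 * h"
    proof (cases "h = 0")
      case False
      then have "p * s \<in> psub (insert t S)" "p * s \<noteq> 0"
        using c h p s unfolding s[symmetric] by (auto intro!: psub_mult intro: psub_mono[of S])
      then have "s \<in> psub (insert t S)" using psub_factor by blast
      moreover have "c1 dvd p * s" using s by (metis dvd_triv_left)
      ultimately have "c1 dvd s" using c p \<open>\<not> c1 dvd p\<close> unfolding prime_in_def by blast
      then obtain s' where "s = c1 * s'" by (elim dvdE)
      then have "c1 * (c2 * h) = c1 * (p * s')" using s by (simp add: mult.left_commute)
      then show ?thesis using c by (simp add: mpoly_mult_cancel_left)
    qed simp
    then show ?thesis using less.hyps[of c2] c by auto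
  qed
qed

text \<open>Irreducibility of \<open>p\<close> persists over the fraction field of
  \<open>psub S\<close>: each prime factor of \<open>c\<close> cancels against \<open>d\<close> or
  \<open>s\<close>. Once \<open>c\<close> is a unit, \<open>p\<close> is a product in which either
  \<open>d\<close> or its cofactor is a unit.\<close>

lemma irreducible_dvd_or_mdeg_0:
  fixes p c d s :: "('v, 'k) mpoly"
  assumes p: "irreducible p" "p \<in> psub (insert t S)"
    and c: "c \<in> psub S" "c \<noteq> 0" and eq: "c * p = d * s"
  shows "p dvd d \<or> mdeg t d = 0"
  using c eq
proof (induction "tdeg c" arbitrary: c d s rule: less_induct)
  case less
  have p0: "p \<noteq> 0" using p by auto
  show ?case
  proof (cases "c dvd 1")
    case True
    then obtain e where e: "1 = c * e" by (elim dvdE)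
    have "p = c * e * p" by (simp flip: e)
    also have "\<dots> = c * p * e" by (simp add: mult_ac)
    finally have "p = d * (s * e)" by (simp add: less.prems mult.assoc)
    then have "d dvd 1 \<or> s * e dvd 1" using p by (auto simp: irreducible_def)
    moreover have "p dvd d" if unit: "s * e dvd 1"
    proof -
      obtain e' where "1 = s * e * e'" using unit by (elim dvdE)
      then have "d = p * e'" using \<open>p = d * (s * e)\<close> by (metis mult.assoc mult_1_right)
      then show ?thesis by simp
    qed
    ultimately show ?thesis using mdeg_unit[of d t] by argo
  next
    case False
    then obtain c1 c2 where c: "c = c1 * c2" "c1 \<in> psub S" "c2 \<in> psub S" "c1 \<noteq> 0" "c2 \<noteq> 0"
      "\<not> c1 dvd 1" "mdeg t c1 = 0" "prime_in (insert t S) c1" "tdeg c2 < tdeg c"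
      using psub_split_prime less.prems by metis
    have "d * s \<in> psub (insert t S)" "d * s \<noteq> 0"
      using less.prems p p0 unfolding less.prems(3)[symmetric] by (auto intro!: psub_mult intro: psub_mono[of S])
    then have ds: "d \<in> psub (insert t S)" "s \<in> psub (insert t S)" "d \<noteq> 0"
      using psub_factor[of d s] by auto
    have "c1 dvd d * s" unfolding less.prems(3)[symmetric] using c by simp
    then have "c1 dvd d \<or> c1 dvd s" using c ds unfolding prime_in_def by blast
    then show ?thesis
    proof
      assume "c1 dvd d"
      then obtain d' where d': "d = c1 * d'" by (elim dvdE)
      then have "c1 * (c2 * p) = c1 * (d' * s)" using less.prems c by (simp add: mult.assoc)
      then have "c2 * p = d' * s" using c by (simp add: mpoly_mult_cancel_left)
      then have "p dvd d' \<or> mdeg t d' = 0" using less.hyps[of c2] c by auto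
      then show ?thesis using d' ds c by (auto simp: mdeg_mult)
    next
      assume "c1 dvd s"
      then obtain s' where s': "s = c1 * s'" by (elim dvdE)
      then have "c1 * (c2 * p) = c1 * (d * s')" using less.prems c by (simp add: mult.assoc mult.left_commute)
      then have "c2 * p = d * s'" using c by (simp add: mpoly_mult_cancel_left)
      then show ?thesis using less.hyps[of c2] c by auto
    qed
  qed
qed

text \<open>An element \<open>d\<close> of least degree in \<open>t\<close> in the ideal generated
  by \<open>p\<close> and \<open>g\<close> divides both up to denominators. If \<open>p\<close>
  divides \<open>d\<close>, then it divides \<open>g\<close>; if \<open>d\<close> is free of
  \<open>t\<close>, the Bezout identity for \<open>d\<close>, multiplied by \<open>h\<close>, shows
  that \<open>p\<close> divides \<open>h\<close>.\<close>

lemma irreducible_imp_prime_insert: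
  fixes p :: "('v, 'k) mpoly"
  assumes p: "p \<in> psub (insert t S)" "irreducible p"
  shows "prime_in (insert t S) p"
proof (cases "mdeg t p = 0")
  case True
  then have "p \<in> psub S" using p psub_insert_mdeg_0[of p t S] by blast
  then show ?thesis using prime_in_insert[OF t] prime_S p by blast
next
  case False
  then have deg: "0 < mdeg t p" by simp
  show ?thesis unfolding prime_in_def
  proof (intro ballI impI)
    fix g h assume g: "g \<in> psub (insert t S)" and h: "h \<in> psub (insert t S)" and dvd: "p dvd g * h"
    define I where "I = {\<alpha> * p + \<beta> * g | \<alpha> \<beta>. \<alpha> \<in> psub (insert t S) \<and> \<beta> \<in> psub (insert t S)}"
    have II: "\<alpha> * p + \<beta> * g \<in> I" if "\<alpha> \<in> psub (insert t S)" "\<beta> \<in> psub (insert t S)" for \<alpha> \<beta>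
      using that by (auto simp: I_def)
    have pI: "p \<in> I" using II[of 1 0] by simp
    have gI: "g \<in> I" using II[of 0 1] by simp
    have I: "I \<subseteq> psub (insert t S)" using p g by (auto simp: I_def intro!: psub_add psub_mult)
    have diff: "u - v \<in> I" if uv: "u \<in> I" "v \<in> I" for u v
    proof -
      obtain a b a' b' where *: "u = a * p + b * g" "v = a' * p + b' * g"
        "a \<in> psub (insert t S)" "b \<in> psub (insert t S)" "a' \<in> psub (insert t S)" "b' \<in> psub (insert t S)"
        using uv by (auto simp: I_def)
      then have "u - v = (a - a') * p + (b - b') * g" by (simp add: algebra_simps)
      then show ?thesis using II * psub_diff by metis
    qed
    have mult: "a * u \<in> I" if au: "a \<in> psub (insert t S)" "u \<in> I" for a u
    proof -
      obtain b b' where *: "u = b * p + b' * g" "b \<in> psub (insert t S)" "b' \<in> psub (insert t S)"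
        using au by (auto simp: I_def)
      then have "a * u = (a * b) * p + (a * b') * g" by (simp add: algebra_simps)
      then show ?thesis using II * au psub_mult by metis
    qed
    have "p \<noteq> 0" using p by auto
    then obtain d where d: "d \<in> I" "d \<noteq> 0" and min: "\<And>u. u \<in> I \<Longrightarrow> u \<noteq> 0 \<Longrightarrow> mdeg t d \<le> mdeg t u"
      using ex_has_least_nat[of "\<lambda>u. u \<in> I \<and> u \<noteq> 0" p "mdeg t"] pI by blast
    obtain c where c: "c \<in> psub S" "c \<noteq> 0" "d dvd c * p"
      using min_mdeg_dvd[OF t I diff mult d min pI] by blast
    obtain c' where c': "c' \<in> psub S" "c' \<noteq> 0" "d dvd c' * g"
      using min_mdeg_dvd[OF t I diff mult d min gI] by blast
    obtain s where s: "c * p = d * s" using c(3) by (elim dvdE)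
    from irreducible_dvd_or_mdeg_0[OF p(2,1) c(1,2) s] show "p dvd g \<or> p dvd h"
    proof
      assume "p dvd d"
      then have "p dvd c' * g" using c' dvd_trans by blast
      then show ?thesis using irreducible_dvd_cancel[OF p(2,1) deg c'(1,2) g] by blast
    next
      assume "mdeg t d = 0"
      then have "d \<in> psub S" using d I psub_insert_mdeg_0[of d t S] by blast
      moreover obtain \<alpha> \<beta> where "d = \<alpha> * p + \<beta> * g" using d by (auto simp: I_def)
      then have "d * h = \<alpha> * h * p + \<beta> * (g * h)" by (simp add: algebra_simps)
      then have "p dvd d * h" using dvd by simp
      ultimately show ?thesis using irreducible_dvd_cancel[OF p(2,1) deg _ d(2) h] by blast
    qed
  qed
qed

end

text \<open>Variables are adjoined one at a time; without variables every nonzero polynomial is a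
  unit, so none is irreducible.\<close>

lemma irreducible_imp_prime_in:
  assumes "finite S" "p \<in> psub S" "irreducible p"
  shows "prime_in S p"
  using assms
proof (induction S arbitrary: p rule: finite_induct)
  case empty
  then have "tdeg p = 0" by (simp add: psub_def tdeg_def)
  then have "p dvd 1" using empty by (auto simp: mpoly_unit_iff)
  then show ?case using empty by (simp add: irreducible_def)
next
  case (insert t S)
  then show ?case using irreducible_imp_prime_insert by blast
qed

theorem mpoly_irreducible_imp_prime:
  "irreducible p \<Longrightarrow> prime_elem (p :: ('v::finite, 'k::field_char_0) mpoly)"
  using irreducible_imp_prime_in[of UNIV p] by (auto simp: prime_elem_def irreducible_def prime_in_def)

section \<open>Prime ideals and derivations\<close>

locale mpoly_prime_ideal =
  fixes Q :: "('v::finite, 'k::field_char_0) mpoly set"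
  assumes ideal_add: "p \<in> Q \<Longrightarrow> q \<in> Q \<Longrightarrow> p + q \<in> Q"
    and ideal_mult: "q \<in> Q \<Longrightarrow> p * q \<in> Q"
    and ideal_0: "0 \<in> Q" and ideal_1: "1 \<notin> Q"
    and ideal_prime: "p * q \<in> Q \<Longrightarrow> p \<in> Q \<or> q \<in> Q"
begin

lemma ideal_mult_right: "q \<in> Q \<Longrightarrow> q * p \<in> Q"
  using ideal_mult[of q p] by (simp add: mult.commute)

lemma ideal_diff: "p \<in> Q \<Longrightarrow> q \<in> Q \<Longrightarrow> p - q \<in> Q"
  using ideal_add[of p "- 1 * q"] ideal_mult[of q "- 1"] by simp

lemma ideal_add_iff: "q \<in> Q \<Longrightarrow> p + q \<in> Q \<longleftrightarrow> p \<in> Q"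
  using ideal_add[of p q] ideal_diff[of "p + q" q] by auto

lemma ideal_mult_iff: "p * q \<in> Q \<longleftrightarrow> p \<in> Q \<or> q \<in> Q"
  using ideal_prime ideal_mult ideal_mult_right by blast

lemma ideal_dvd: "p \<in> Q \<Longrightarrow> p dvd q \<Longrightarrow> q \<in> Q"
  by (auto simp: ideal_mult_right)

lemma ideal_not_unit: "p \<in> Q \<Longrightarrow> \<not> p dvd 1"
  using ideal_dvd ideal_1 by blast

lemma ideal_const: "mconst c \<in> Q \<longleftrightarrow> c = 0"
  using ideal_not_unit[of "mconst c"] mconst_unit[of c] ideal_0 by (cases "c = 0") auto

text \<open>An \<open>r\<close> of least \<open>tdeg\<close> is irreducible because \<open>Q\<close>
  is prime. An element \<open>d\<close> of least degree in \<open>t\<close> divides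
  \<open>c * r\<close> and \<open>c' * v\<close>. Since \<open>Q\<close> meets \<open>psub S\<close>
  only in 0, \<open>r\<close> divides neither \<open>c'\<close> nor the cofactor \<open>s\<close> of
  \<open>d\<close>, so primality carries \<open>r\<close> over to \<open>d\<close> and then to
  \<open>v\<close>.\<close>

lemma ideal_principal:
  assumes t: "t \<notin> S" and S: "Q \<inter> psub S = {0}" and q: "q \<in> Q" "q \<in> psub (insert t S)" "q \<noteq> 0"
  obtains r where "r \<in> Q" "r \<in> psub (insert t S)" "irreducible r" "0 < mdeg t r"
    "\<And>v. v \<in> Q \<Longrightarrow> v \<in> psub (insert t S) \<Longrightarrow> r dvd v"
proof -
  let ?T = "psub (insert t S) :: ('v, 'k) mpoly set"
  obtain r where r: "r \<in> Q" "r \<in> ?T" "r \<noteq> 0"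
    and rmin: "\<And>u. u \<in> Q \<Longrightarrow> u \<in> ?T \<Longrightarrow> u \<noteq> 0 \<Longrightarrow> tdeg r \<le> tdeg u"
    using ex_has_least_nat[of "\<lambda>u. u \<in> Q \<and> u \<in> ?T \<and> u \<noteq> 0" q tdeg] q by blast
  have irr: "irreducible r"
  proof (rule irreducibleI)
    fix a b assume ab: "r = a * b"
    then have n0: "a \<noteq> 0" "b \<noteq> 0" and T: "a \<in> ?T" "b \<in> ?T"
      using r psub_factor[of a b "insert t S"] by auto
    have "a \<in> Q \<or> b \<in> Q" using ab r ideal_prime by blast
    then have "tdeg a = 0 \<or> tdeg b = 0"
      using rmin[of a] rmin[of b] n0 T ab by (auto simp: tdeg_mult)
    then show "a dvd 1 \<or> b dvd 1" using n0 by (auto simp: mpoly_unit_iff)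
  qed (use r ideal_not_unit in auto)
  have pos: "0 < mdeg t u" if "u \<in> Q" "u \<in> ?T" "u \<noteq> 0" for u
    using that S psub_insert_mdeg_0[of u t S] by (cases "mdeg t u = 0") auto
  have "r dvd v" if v: "v \<in> Q" "v \<in> ?T" for v
  proof -
    let ?I = "Q \<inter> ?T"
    have I: "?I \<subseteq> ?T" by simp
    have diff: "u - v \<in> ?I" if "u \<in> ?I" "v \<in> ?I" for u v
      using that by (simp add: ideal_diff psub_diff)
    have mult: "a * u \<in> ?I" if "a \<in> ?T" "u \<in> ?I" for a u
      using that by (simp add: ideal_mult psub_mult)
    obtain d where d: "d \<in> ?I" "d \<noteq> 0" and dmin: "\<And>u. u \<in> ?I \<Longrightarrow> u \<noteq> 0 \<Longrightarrow> mdeg t d \<le> mdeg t u"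
      using ex_has_least_nat[of "\<lambda>u. u \<in> ?I \<and> u \<noteq> 0" r "mdeg t"] r by blast
    obtain c where c: "c \<in> psub S" "c \<noteq> 0" "d dvd c * r"
      using min_mdeg_dvd[OF t I diff mult d dmin, of r] r by blast
    obtain c' where c': "c' \<in> psub S" "c' \<noteq> 0" "d dvd c' * v"
      using min_mdeg_dvd[OF t I diff mult d dmin, of v] v by blast
    have prime: "prime_elem r" using irr by (rule mpoly_irreducible_imp_prime)
    obtain s where s: "c * r = d * s" using c(3) by (elim dvdE)
    have "\<not> r dvd s"
    proof
      assume "r dvd s"
      then obtain s' where "s = r * s'" by (elim dvdE)
      then have "r * c = r * (d * s')" using s by (simp add: mult_ac)
      then have cd: "c = d * s'" using r by (simp add: mpoly_mult_cancel_left)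
      then have "d \<in> psub S" using c psub_factor by blast
      then show False using d S by auto
    qed
    moreover have "r dvd d * s" unfolding s[symmetric] by simp
    ultimately have "r dvd d" using prime prime_elem_dvd_multD by blast
    then have "r dvd c' * v" using c' dvd_trans by blast
    moreover have "\<not> r dvd c'"
    proof
      assume "r dvd c'"
      then obtain z where "c' = r * z" by (elim dvdE)
      then have "r \<in> psub S" using c' psub_factor by blast
      then show False using r S by auto
    qed
    ultimately show ?thesis using prime prime_elem_dvd_multD by blast
  qed
  then show thesis using that r irr pos by blast
qed

text \<open>\<open>S\<close> is a maximal set of variables algebraically independent modulo
  \<open>Q\<close>, so every other variable is algebraic over \<open>S\<close>. It omits some
  \<open>t\<close> because \<open>Q\<close> contains \<open>q\<close>.\<close>

lemma exists_transcendence_basis: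
  assumes "q \<in> Q" "q \<noteq> 0"
  obtains S t where "t \<notin> S" "Q \<inter> psub S = {0}"
    "\<And>t'. t' \<notin> S \<Longrightarrow> \<exists>u. u \<in> Q \<and> u \<in> psub (insert t' S) \<and> u \<noteq> 0"
proof -
  let ?F = "{S :: 'v set. Q \<inter> psub S = {0}}"
  have "{} \<in> ?F"
  proof -
    have "p = 0" if "p \<in> Q" "p \<in> psub {}" for p
      using that all_mdeg_0_const[of p] ideal_const by (auto simp: psub_def)
    then show ?thesis using ideal_0 by auto
  qed
  then obtain S where S: "S \<in> ?F" and max: "\<And>T. T \<in> ?F \<Longrightarrow> S \<subseteq> T \<Longrightarrow> S = T"
    using finite_has_maximal2[of ?F "{}"] by auto
  have "S \<noteq> UNIV"
  proof
    assume "S = UNIV"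
    then have "q \<in> {0}" using S assms(1) by simp
    then show False using assms(2) by simp
  qed
  then obtain t where t: "t \<notin> S" by auto
  have "\<exists>u. u \<in> Q \<and> u \<in> psub (insert t' S) \<and> u \<noteq> 0" if "t' \<notin> S" for t'
  proof -
    have "insert t' S \<notin> ?F" using max[of "insert t' S"] that by (metis insertI1 subset_insertI)
    moreover have "0 \<in> Q \<inter> psub (insert t' S)" using ideal_0 by simp
    ultimately show ?thesis by blast
  qed
  moreover have "Q \<inter> psub S = {0}" using S by simp
  ultimately show thesis using that[of t S] t by simp
qed

end

text \<open>In characteristic zero the derivative is nonzero and of smaller degree in
  \<open>t\<close>.\<close>

lemma not_dvd_mpderiv:
  fixes p :: "('v::finite, 'k::field_char_0) mpoly"
  assumes "0 < mdeg t p"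
  shows "\<not> p dvd mpderiv t p"
proof
  assume "p dvd mpderiv t p"
  then obtain q where q: "mpderiv t p = p * q" by (elim dvdE)
  have "p \<noteq> 0" "q \<noteq> 0" using mpderiv_ne_0[OF assms] q by auto
  then have "mdeg t p \<le> mdeg t (mpderiv t p)" by (simp add: q mdeg_mult)
  then show False using mdeg_mpderiv_less[OF assms] by simp
qed

section \<open>Derivations along a substitution\<close>

lemma msubst_cong_psub:
  assumes p: "p \<in> psub S" and eq: "\<And>s. s \<in> S \<Longrightarrow> G s = G' s"
  shows "msubst p G = msubst p (G' :: 'm::finite \<Rightarrow> ('n, 'k::comm_ring_1) mpoly)"
  unfolding msubst_def
proof (intro sum.cong refl arg_cong2[where f = "(*)"] prod.cong)
  fix m a assume m: "m \<in> keys p"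
  show "G a ^ lookup m a = G' a ^ lookup m a"
  proof (cases "a \<in> S")
    case False
    then have "lookup m a = 0" using p m mdeg_le_iff[of a p 0] by (auto simp: psub_def)
    then show ?thesis by simp
  qed (simp add: eq)
qed

lemma msubst_sum: "msubst (\<Sum>b\<in>A. H b) F = (\<Sum>b\<in>A. msubst (H b) F)"
  for F :: "'m::finite \<Rightarrow> ('n, 'k::comm_ring_1) mpoly"
  by (induction A rule: infinite_finite_induct) (simp_all add: msubst_add)

text \<open>The derivation over \<open>k\<close> that sends the variable \<open>s\<close> to
  \<open>\<delta> s\<close>, where the target is a module through the substitution of
  \<open>\<theta>\<close>.\<close>

definition dirderiv :: "('p::finite \<Rightarrow> ('n, 'k::comm_ring_1) mpoly) \<Rightarrow> ('p \<Rightarrow> ('n, 'k) mpoly) \<Rightarrow> ('p, 'k) mpoly \<Rightarrow> ('n, 'k) mpoly" where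
  "dirderiv \<theta> \<delta> p = (\<Sum>s\<in>UNIV. \<delta> s * msubst (mpderiv s p) \<theta>)"

lemma dirderiv_add: "dirderiv \<theta> \<delta> (p + q) = dirderiv \<theta> \<delta> p + dirderiv \<theta> \<delta> q"
  by (simp add: dirderiv_def mpderiv_add msubst_add distrib_left sum.distrib)

lemma dirderiv_diff: "dirderiv \<theta> \<delta> (p - q) = dirderiv \<theta> \<delta> p - dirderiv \<theta> \<delta> q"
  by (simp add: dirderiv_def mpderiv_diff msubst_diff right_diff_distrib sum_subtractf)

lemma dirderiv_mult:
  "dirderiv \<theta> \<delta> (p * q) = dirderiv \<theta> \<delta> p * msubst q \<theta> + msubst p \<theta> * dirderiv \<theta> \<delta> q"
  by (simp add: dirderiv_def mpderiv_mult msubst_mult msubst_add sum_distrib_left sum_distrib_right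
      mult_ac distrib_left sum.distrib)

lemma dirderiv_const [simp]: "dirderiv \<theta> \<delta> (mconst c) = 0"
  by (simp add: dirderiv_def)

lemma dirderiv_0 [simp]: "dirderiv \<theta> \<delta> 0 = 0"
  by (simp add: dirderiv_def)

lemma dirderiv_var [simp]: "dirderiv \<theta> \<delta> (mvar s) = \<delta> s"
proof -
  have "dirderiv \<theta> \<delta> (mvar s) = (\<Sum>s'\<in>UNIV. if s' = s then \<delta> s' else 0)"
    unfolding dirderiv_def by (intro sum.cong) (auto simp: mpderiv_var)
  then show ?thesis by simp
qed

lemma dirderiv_sum: "dirderiv \<theta> \<delta> (\<Sum>i\<in>A. F i) = (\<Sum>i\<in>A. dirderiv \<theta> \<delta> (F i))"
  by (induction A rule: infinite_finite_induct) (simp_all add: dirderiv_add)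

lemma dirderiv_msubst:
  "dirderiv \<theta> \<delta> (msubst u G) =
    (\<Sum>b\<in>UNIV. msubst (mpderiv b u) (\<lambda>b. msubst (G b) \<theta>) * dirderiv \<theta> \<delta> (G b))"
proof -
  have "dirderiv \<theta> \<delta> (msubst u G) = (\<Sum>s\<in>UNIV. \<Sum>b\<in>UNIV.
      msubst (mpderiv b u) (\<lambda>b. msubst (G b) \<theta>) * (\<delta> s * msubst (mpderiv s (G b)) \<theta>))"
    unfolding dirderiv_def
  proof (intro sum.cong refl)
    fix s
    show "\<delta> s * msubst (mpderiv s (msubst u G)) \<theta> = (\<Sum>b\<in>UNIV.
      msubst (mpderiv b u) (\<lambda>b. msubst (G b) \<theta>) * (\<delta> s * msubst (mpderiv s (G b)) \<theta>))"
      by (simp add: mpderiv_msubst msubst_sum msubst_mult msubst_msubst sum_distrib_left mult_ac)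
  qed
  also have "\<dots> = (\<Sum>b\<in>UNIV. msubst (mpderiv b u) (\<lambda>b. msubst (G b) \<theta>) * dirderiv \<theta> \<delta> (G b))"
    by (subst sum.swap) (simp add: dirderiv_def sum_distrib_left)
  finally show ?thesis .
qed

lemma dirderiv_scale:
  fixes p :: "('p::finite, 'k::comm_ring_1) mpoly"
  assumes "p \<in> psub S" "\<And>s. s \<in> S \<Longrightarrow> \<delta>' s = e * \<delta> s"
  shows "dirderiv \<theta> \<delta>' p = e * dirderiv \<theta> \<delta> p"
  unfolding dirderiv_def sum_distrib_left
proof (intro sum.cong refl)
  fix s
  show "\<delta>' s * msubst (mpderiv s p) \<theta> = e * (\<delta> s * msubst (mpderiv s p) \<theta>)"
  proof (cases "s \<in> S")
    case False
    then have "mpderiv s p = 0" using assms by (intro mpderiv_mdeg_0 mdeg_psub)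
    then show ?thesis by simp
  qed (simp add: assms mult.assoc)
qed

text \<open>The algebraic relations among the residues of the \<open>\<theta> s\<close> modulo
  \<open>g\<close>. For \<open>\<theta> = f\<close> this is the ideal P of the introduction.\<close>

definition relations :: "('n::finite, 'k::field_char_0) mpoly \<Rightarrow> ('p::finite \<Rightarrow> ('n, 'k) mpoly) \<Rightarrow> ('p, 'k) mpoly set" where
  "relations g \<theta> = {p. g dvd msubst p \<theta>}"

lemma relations_prime_ideal:
  assumes "prime_elem g"
  shows "mpoly_prime_ideal (relations g \<theta>)"
proof
  fix p q
  show "p + q \<in> relations g \<theta>" if "p \<in> relations g \<theta>" "q \<in> relations g \<theta>"
    using that by (simp add: relations_def msubst_add)
  show "p * q \<in> relations g \<theta>" if "q \<in> relations g \<theta>"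
    using that by (simp add: relations_def msubst_mult)
  show "p \<in> relations g \<theta> \<or> q \<in> relations g \<theta>" if "p * q \<in> relations g \<theta>"
    using that prime_elem_dvd_multD[OF assms] by (simp add: relations_def msubst_mult)
qed (use prime_elem_not_unit[OF assms] in \<open>simp_all add: relations_def\<close>)

section \<open>Extending derivations to further generators modulo a prime\<close>

context
  fixes g :: "('n::finite, 'k::field_char_0) mpoly" and \<theta> :: "'p::finite \<Rightarrow> ('n, 'k) mpoly"
  assumes g: "prime_elem g"
begin

interpretation Q: mpoly_prime_ideal "relations g \<theta>"
  by (rule relations_prime_ideal[OF g])

text \<open>This says that \<open>\<delta>\<close> induces a well-defined derivation with values in
  A/g on the subring of A/g generated by the residues of \<open>\<theta> s\<close> for
  \<open>s\<close> in \<open>S\<close>.\<close>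

definition tangent :: "'p set \<Rightarrow> ('p \<Rightarrow> ('n, 'k) mpoly) \<Rightarrow> bool" where
  "tangent S \<delta> \<longleftrightarrow> (\<forall>p\<in>psub S \<inter> relations g \<theta>. g dvd dirderiv \<theta> \<delta> p)"

text \<open>By the product rule, both contributions of each term \<open>?c i * mvar t ^ i\<close>
  are divisible by \<open>g\<close>, whatever value \<open>\<delta>'\<close> takes at
  \<open>t\<close>.\<close>

lemma tangent_coeffs:
  assumes \<delta>: "tangent S \<delta>" "\<And>s. s \<in> S \<Longrightarrow> \<delta>' s = e * \<delta> s"
    and p: "p \<in> psub (insert t S)" "\<And>i. coeff (upoly t p) i \<in> relations g \<theta>"
  shows "g dvd dirderiv \<theta> \<delta>' p"
proof -
  let ?c = "coeff (upoly t p)"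
  have c: "g dvd dirderiv \<theta> \<delta>' (?c i)" "g dvd msubst (?c i) \<theta>" for i
  proof -
    have ci: "?c i \<in> psub S" using p by (intro psub_coeff)
    have "g dvd dirderiv \<theta> \<delta> (?c i)" using \<delta>(1) ci p unfolding tangent_def by blast
    then show "g dvd dirderiv \<theta> \<delta>' (?c i)" using dirderiv_scale[OF ci \<delta>(2)] by simp
    show "g dvd msubst (?c i) \<theta>" using p by (simp add: relations_def)
  qed
  have "p = (\<Sum>i\<le>degree (upoly t p). ?c i * mvar t ^ i)"
    using poly_altdef[of "upoly t p" "mvar t"] by simp
  then have "dirderiv \<theta> \<delta>' p = (\<Sum>i\<le>degree (upoly t p). dirderiv \<theta> \<delta>' (?c i * mvar t ^ i))"
    using dirderiv_sum[of \<theta> \<delta>' "\<lambda>i. ?c i * mvar t ^ i"] by metis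
  also have "g dvd \<dots>"
    by (intro dvd_sum) (auto simp: dirderiv_mult c)
  finally show ?thesis .
qed

text \<open>The dropped top term is itself a relation. This yields a relation of smaller degree
  whenever the leading coefficient is a relation.\<close>

lemma coeffs_rel_reduce:
  assumes p: "p \<in> psub (insert t S)" and lc: "lcf t p \<in> relations g \<theta>"
  defines "p' \<equiv> p - lcf t p * mvar t ^ mdeg t p"
  shows "p' \<in> psub (insert t S)" "p \<in> relations g \<theta> \<Longrightarrow> p' \<in> relations g \<theta>"
    "(\<forall>i. coeff (upoly t p') i \<in> relations g \<theta>) \<longleftrightarrow> (\<forall>i. coeff (upoly t p) i \<in> relations g \<theta>)"
proof -
  have "lcf t p \<in> psub (insert t S)" by (rule psub_mono[OF subset_insertI psub_lcf[OF p]])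
  then show "p' \<in> psub (insert t S)"
    using p unfolding p'_def by (intro psub_diff psub_mult psub_power psub_var) auto
  show "p \<in> relations g \<theta> \<Longrightarrow> p' \<in> relations g \<theta>"
    using lc by (simp add: p'_def Q.ideal_diff Q.ideal_mult_right)
  have "upoly t p' = upoly t p - monom (lcf t p) (mdeg t p)"
    by (simp add: p'_def upoly_diff upoly_mult upoly_power upoly_var monom_power mdeg_eq_0_imp smult_monom)
  then have "coeff (upoly t p') i = (if i = mdeg t p then 0 else coeff (upoly t p) i)" for i
    by (simp add: lcf_def mdeg_def)
  then have "coeff (upoly t p') i \<in> relations g \<theta> \<longleftrightarrow> coeff (upoly t p) i \<in> relations g \<theta>" for i
    using lc Q.ideal_0 by (cases "i = mdeg t p") (simp_all add: lcf_def mdeg_def)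
  then show "(\<forall>i. coeff (upoly t p') i \<in> relations g \<theta>) \<longleftrightarrow> (\<forall>i. coeff (upoly t p) i \<in> relations g \<theta>)"
    by simp
qed

text \<open>
  Derivations extend along algebraic and along transcendental generators. As the base ring is A/g and
  not its field of fractions, the extension is only obtained after multiplication by some e prime to g.
\<close>

lemma tangent_extend:
  assumes t: "t \<notin> S" and \<delta>: "tangent S \<delta>"
  shows "\<exists>e \<delta>'. \<not> g dvd e \<and> (\<forall>s\<in>S. \<delta>' s = e * \<delta> s) \<and> tangent (insert t S) \<delta>'"
proof (cases "\<forall>p\<in>psub (insert t S) \<inter> relations g \<theta>. \<forall>i. coeff (upoly t p) i \<in> relations g \<theta>")
  case True
  \<comment> \<open>The transcendental case: every relation holds coefficientwise, any value at
    \<open>t\<close> is admissible, and the present one is kept.\<close>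
  have "tangent (insert t S) \<delta>"
    unfolding tangent_def
  proof
    fix p assume "p \<in> psub (insert t S) \<inter> relations g \<theta>"
    then show "g dvd dirderiv \<theta> \<delta> p"
      using True by (intro tangent_coeffs[OF \<delta>, of \<delta> 1 p t]) simp_all
  qed
  then show ?thesis using g by (intro exI[of _ 1] exI[of _ \<delta>]) (auto simp: prime_elem_def)
next
  case False
  let ?R = "relations g \<theta>" and ?T = "psub (insert t S) :: ('p, 'k) mpoly set"
  \<comment> \<open>The algebraic case: a relation of least degree in \<open>t\<close> that fails
    coefficientwise plays the part of a minimal polynomial of \<open>\<theta> t\<close> modulo
    \<open>g\<close>.\<close>
  define bad where "bad = (\<lambda>p. p \<in> ?T \<and> p \<in> ?R \<and> \<not> (\<forall>i. coeff (upoly t p) i \<in> ?R))"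
  obtain \<Phi> where \<Phi>: "bad \<Phi>" and min: "\<And>p. bad p \<Longrightarrow> mdeg t \<Phi> \<le> mdeg t p"
    using False ex_has_least_nat[of bad _ "mdeg t"] unfolding bad_def by blast
  have \<Phi>T: "\<Phi> \<in> ?T" "\<Phi> \<in> ?R" "\<not> (\<forall>i. coeff (upoly t \<Phi>) i \<in> ?R)"
    using \<Phi> unfolding bad_def by blast+
  have deg: "0 < mdeg t \<Phi>"
  proof (rule ccontr)
    assume "\<not> 0 < mdeg t \<Phi>"
    then have "upoly t \<Phi> = [:\<Phi>:]" by (simp add: mdeg_eq_0_imp)
    then have "coeff (upoly t \<Phi>) i = 0 \<or> coeff (upoly t \<Phi>) i = \<Phi>" for i by (cases i) auto
    then have "coeff (upoly t \<Phi>) i \<in> ?R" for i using \<Phi>T(2) Q.ideal_0 by metis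
    then show False using \<Phi>T(3) by simp
  qed
  have \<Phi>0: "\<Phi> \<noteq> 0" using deg by auto
  have good: "coeff (upoly t p) i \<in> ?R" if "p \<in> ?T" "p \<in> ?R" "mdeg t p < mdeg t \<Phi>" for p i
    using min[of p] that unfolding bad_def by auto
  have lc: "lcf t \<Phi> \<notin> ?R"
  proof
    assume lc: "lcf t \<Phi> \<in> ?R"
    have "bad (\<Phi> - lcf t \<Phi> * mvar t ^ mdeg t \<Phi>)"
      using coeffs_rel_reduce(1,2)[OF \<Phi>T(1) lc] \<Phi>T
      unfolding bad_def coeffs_rel_reduce(3)[OF \<Phi>T(1) lc] by blast
    then show False using min mdeg_drop_lcf[OF deg] by fastforce
  qed
  \<comment> \<open>Separability: were the derivative a relation, minimality would make its leading
    coefficient one too, and this is a nonzero integer times that of \<open>\<Phi>\<close>.\<close>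
  have d\<Phi>: "mpderiv t \<Phi> \<notin> ?R"
  proof
    assume "mpderiv t \<Phi> \<in> ?R"
    then have "lcf t (mpderiv t \<Phi>) \<in> ?R"
      unfolding lcf_def[of t "mpderiv t \<Phi>"] using \<Phi>T deg
      by (intro good psub_mpderiv mdeg_mpderiv_less) simp_all
    then show False using lc deg by (simp add: lcf_mpderiv Q.ideal_mult_iff Q.ideal_const)
  qed
  define e where "e = msubst (mpderiv t \<Phi>) \<theta>"
  \<comment> \<open>The value at \<open>t\<close> solves
    \<open>dirderiv \<theta> \<delta>' \<Phi> = 0\<close>; scaling the other values by
    \<open>e\<close> replaces the division by \<open>e\<close>.\<close>
  define \<delta>' where "\<delta>' = (\<lambda>s. if s = t then - (\<Sum>s\<in>UNIV - {t}. \<delta> s * msubst (mpderiv s \<Phi>) \<theta>) else e * \<delta> s)"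
  have ne: "\<not> g dvd e" using d\<Phi> by (simp add: e_def relations_def)
  have \<delta>'S: "\<delta>' s = e * \<delta> s" if "s \<in> S" for s using that t by (auto simp: \<delta>'_def)
  have D\<Phi>: "dirderiv \<theta> \<delta>' \<Phi> = 0"
  proof -
    have "dirderiv \<theta> \<delta>' \<Phi> = \<delta>' t * e + (\<Sum>s\<in>UNIV - {t}. \<delta>' s * msubst (mpderiv s \<Phi>) \<theta>)"
      unfolding dirderiv_def e_def by (simp add: sum.remove)
    also have "(\<Sum>s\<in>UNIV - {t}. \<delta>' s * msubst (mpderiv s \<Phi>) \<theta>) =
        (\<Sum>s\<in>UNIV - {t}. e * (\<delta> s * msubst (mpderiv s \<Phi>) \<theta>))"
      by (intro sum.cong) (auto simp: \<delta>'_def mult.assoc)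
    finally show ?thesis by (simp add: \<delta>'_def sum_distrib_left[symmetric] mult.commute)
  qed
  have "g dvd dirderiv \<theta> \<delta>' p" if "p \<in> ?T" "p \<in> ?R" for p
    using that
  proof (induction "mdeg t p" arbitrary: p rule: less_induct)
    case less
    show ?case
    proof (cases "p = 0 \<or> mdeg t p < mdeg t \<Phi>")
      case True
      then have "coeff (upoly t p) i \<in> ?R" for i using less.prems good Q.ideal_0 by auto
      then show ?thesis using tangent_coeffs[OF \<delta> \<delta>'S] less.prems by blast
    next
      case False
      \<comment> \<open>Pseudo-division by \<open>\<Phi>\<close> reduces \<open>p\<close> to a
        relation of smaller degree, and \<open>lcf t \<Phi>\<close>, not being a relation, cancels
        modulo \<open>g\<close>.\<close>
      define w where "w = lcf t p * mvar t ^ (mdeg t p - mdeg t \<Phi>)"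
      define p' where "p' = lcf t \<Phi> * p - w * \<Phi>"
      have lcT: "lcf t p \<in> ?T" "lcf t \<Phi> \<in> ?T"
        using less.prems(1) \<Phi>T(1)
        by (simp_all add: psub_mono[OF subset_insertI psub_lcf])
      then have "p' \<in> ?T" using less.prems \<Phi>T lcT unfolding p'_def w_def
        by (intro psub_diff psub_mult psub_power psub_var) auto
      moreover have "p' \<in> ?R" using less.prems \<Phi>T unfolding p'_def
        by (intro Q.ideal_diff Q.ideal_mult) auto
      moreover have "p' = 0 \<or> mdeg t p' < mdeg t p"
        unfolding p'_def w_def using False \<Phi>0 by (intro pseudo_reduce) auto
      ultimately have "g dvd dirderiv \<theta> \<delta>' p'" using less.hyps[of p'] by (cases "p' = 0") auto
      moreover have "dirderiv \<theta> \<delta>' p' = dirderiv \<theta> \<delta>' (lcf t \<Phi>) * msubst p \<theta> +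
          msubst (lcf t \<Phi>) \<theta> * dirderiv \<theta> \<delta>' p - dirderiv \<theta> \<delta>' w * msubst \<Phi> \<theta>"
        by (simp add: p'_def dirderiv_diff dirderiv_mult D\<Phi>)
      moreover have "g dvd msubst p \<theta>" "g dvd msubst \<Phi> \<theta>"
        using less.prems(2) \<Phi>T(2) by (simp_all add: relations_def)
      ultimately have "g dvd msubst (lcf t \<Phi>) \<theta> * dirderiv \<theta> \<delta>' p"
        by (simp add: dvd_diff_left_iff dvd_add_right_iff)
      then show ?thesis using g lc by (auto simp: prime_elem_dvd_mult_iff relations_def)
    qed
  qed
  then have "tangent (insert t S) \<delta>'" by (simp add: tangent_def)
  then show ?thesis using ne \<delta>'S by blast
qed

text \<open>Generators are added one at a time; the scaling factors multiply and stay prime to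
  \<open>g\<close>.\<close>

lemma tangent_extend_UNIV:
  assumes "tangent S \<delta>"
  shows "\<exists>e \<delta>'. \<not> g dvd e \<and> (\<forall>s\<in>S. \<delta>' s = e * \<delta> s) \<and> tangent UNIV \<delta>'"
proof -
  have "\<exists>e \<delta>'. \<not> g dvd e \<and> (\<forall>s\<in>S. \<delta>' s = e * \<delta> s) \<and> tangent (S \<union> T) \<delta>'" if "finite T" for T
    using that
  proof (induction T rule: finite_induct)
    case empty
    then show ?case using g assms by (intro exI[of _ 1] exI[of _ \<delta>]) (auto simp: prime_elem_def)
  next
    case (insert t T)
    then obtain e \<delta>' where e: "\<not> g dvd e" "\<forall>s\<in>S. \<delta>' s = e * \<delta> s" "tangent (S \<union> T) \<delta>'" by blast
    show ?case
    proof (cases "t \<in> S")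
      case True
      then show ?thesis using e by (metis Un_insert_right insert_absorb UnCI)
    next
      case False
      then obtain e' \<delta>'' where e': "\<not> g dvd e'" "\<forall>s\<in>S \<union> T. \<delta>'' s = e' * \<delta>' s" "tangent (insert t (S \<union> T)) \<delta>''"
        using tangent_extend[OF _ e(3), of t] insert.hyps by auto
      have "\<not> g dvd e' * e" using g e e' by (simp add: prime_elem_dvd_mult_iff)
      moreover have "\<forall>s\<in>S. \<delta>'' s = e' * e * \<delta> s" using e e' by (simp add: mult.assoc)
      ultimately show ?thesis using e'(3) by auto
    qed
  qed
  from this[of UNIV] show ?thesis by simp
qed

end

text \<open>The derivation given by \<open>\<delta>\<close> at \<open>f\<close> is extended to the
  generators \<open>f\<close> together with all variables of A. The relations
  \<open>mvar (Inl a) - msubst (f a) (mvar \<circ> Inr)\<close> then force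
  \<open>e * \<delta> a\<close> to be the Jacobian image of the new values
  \<open>\<eta>\<close>.\<close>

lemma tangent_in_jacobian_image:
  fixes g :: "('n::finite, 'k::field_char_0) mpoly" and f \<delta> :: "'m::finite \<Rightarrow> ('n, 'k) mpoly"
  assumes g: "prime_elem g" and \<delta>: "\<And>u. u \<in> relations g f \<Longrightarrow> g dvd dirderiv f \<delta> u"
  shows "\<exists>e \<eta>. \<not> g dvd e \<and> (\<forall>a. g dvd e * \<delta> a - (\<Sum>j\<in>UNIV. \<eta> j * mpderiv j (f a)))"
proof -
  define \<theta> :: "'m + 'n \<Rightarrow> ('n, 'k) mpoly" where "\<theta> = case_sum f mvar"
  \<comment> \<open>The zeros on the \<open>Inr\<close> side are placeholders, to be replaced by the
    extension.\<close>
  define \<delta>0 :: "'m + 'n \<Rightarrow> ('n, 'k) mpoly" where "\<delta>0 = case_sum \<delta> (\<lambda>_. 0)"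
  have "tangent g \<theta> (range Inl) \<delta>0"
    unfolding tangent_def[OF g]
  proof
    fix p assume p: "p \<in> psub (range Inl) \<inter> relations g \<theta>"
    define u where "u = msubst p (case_sum mvar (\<lambda>_. 0))"
    have "msubst u (mvar \<circ> Inl) = msubst p mvar"
      unfolding u_def msubst_msubst by (rule msubst_cong_psub[of p "range Inl"]) (use p in auto)
    then have pu: "p = msubst u (mvar \<circ> Inl)" by simp
    have "msubst p \<theta> = msubst u f"
      unfolding pu msubst_msubst by (simp add: \<theta>_def)
    then have "u \<in> relations g f" using p by (simp add: relations_def)
    moreover have "dirderiv \<theta> \<delta>0 p = dirderiv f \<delta> u"
      unfolding pu dirderiv_msubst by (simp add: dirderiv_def[of f] \<delta>0_def \<theta>_def mult.commute)
    ultimately show "g dvd dirderiv \<theta> \<delta>0 p" using \<delta> by simp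
  qed
  then obtain e \<delta>' where e: "\<not> g dvd e" "\<And>a. \<delta>' (Inl a) = e * \<delta> a" and tan: "tangent g \<theta> UNIV \<delta>'"
    using tangent_extend_UNIV[OF g] by (fastforce simp: \<delta>0_def)
  have image: "g dvd e * \<delta> a - (\<Sum>j\<in>UNIV. \<delta>' (Inr j) * mpderiv j (f a))" for a
  proof -
    let ?p = "mvar (Inl a) - msubst (f a) (mvar \<circ> Inr) :: ('m + 'n, 'k) mpoly"
    have "msubst ?p \<theta> = 0" by (simp add: msubst_diff msubst_msubst \<theta>_def)
    then have "g dvd dirderiv \<theta> \<delta>' ?p" using tan by (simp add: tangent_def[OF g] relations_def)
    also have "dirderiv \<theta> \<delta>' ?p = e * \<delta> a - (\<Sum>j\<in>UNIV. \<delta>' (Inr j) * mpderiv j (f a))"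
      unfolding dirderiv_diff dirderiv_msubst by (simp add: \<theta>_def e mult.commute)
    finally show ?thesis .
  qed
  show ?thesis
    by (intro exI[of _ e] exI[of _ "\<lambda>j. \<delta>' (Inr j)"] conjI allI e(1) image)
qed

section \<open>Jacobian minors modulo a prime\<close>

lemma det_row_combination:
  fixes A :: "'a::comm_ring_1^'m^'m"
  shows "det (\<chi> i. if i = k then \<Sum>j\<in>UNIV. v j *s A $ j else A $ i) = v k * det A"
proof -
  have "det (\<chi> i. if i = k then \<Sum>j\<in>UNIV. v j *s A $ j else A $ i) =
      (\<Sum>j\<in>UNIV. v j * det (\<chi> i. if i = k then A $ j else A $ i))"
    by (simp add: det_linear_row_sum det_row_mul)
  also have "\<dots> = (\<Sum>j\<in>UNIV. if j = k then v k * det A else 0)"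
  proof (intro sum.cong refl)
    fix j
    show "v j * det (\<chi> i. if i = k then A $ j else A $ i) = (if j = k then v k * det A else 0)"
    proof (cases "j = k")
      case True
      then have eq: "(\<chi> i. if i = k then A $ j else A $ i) = A" by (simp add: vec_eq_iff)
      show ?thesis unfolding eq using True by simp
    next
      case False
      have "det (\<chi> i. if i = k then A $ j else A $ i) = 0"
        by (rule det_identical_rows[OF False]) (use False in \<open>simp add: row_def vec_eq_iff\<close>)
      then show ?thesis using False by simp
    qed
  qed
  finally show ?thesis by simp
qed

lemma dvd_det_row:
  fixes A :: "'a::comm_ring_1^'m^'m"
  assumes "\<And>j. g dvd A $ k $ j"
  shows "g dvd det A"
  unfolding det_def
  by (intro dvd_sum dvd_mult) (metis UNIV_I assms dvd_prodI dvd_trans finite)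

text \<open>Cramer's rule as a cancellation law: replacing row \<open>k\<close> by the combination
  with coefficients \<open>v\<close> multiplies the determinant by \<open>v k\<close> and makes that
  row divisible by \<open>g\<close>.\<close>

lemma dvd_det_mult:
  fixes A :: "'a::comm_ring_1^'m^'m"
  assumes "\<And>j. g dvd (\<Sum>a\<in>UNIV. v a * A $ a $ j)"
  shows "g dvd v k * det A"
  unfolding det_row_combination[symmetric]
  by (rule dvd_det_row[of _ _ k]) (simp add: sum_component assms)

text \<open>The divisibility half of the Cauchy--Binet formula.\<close>

lemma dvd_det_product:
  fixes col :: "'n::finite \<Rightarrow> 'a::comm_ring_1^'m"
  assumes minors: "\<And>i. inj i \<Longrightarrow> g dvd det (\<chi> b. col (i b))"
  shows "g dvd det (\<chi> b. \<Sum>j\<in>UNIV. M b j *s col j)"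
proof -
  \<comment> \<open>Rows in \<open>T\<close> hold the combinations, the others a single column
    chosen by \<open>i\<close>. Empty \<open>T\<close> gives a minor, or 0 if \<open>i\<close>
    repeats a column; adding an index to \<open>T\<close> expands one row.\<close>
  have "g dvd det (\<chi> b. if b \<in> T then \<Sum>j\<in>UNIV. M b j *s col j else col (i b))" if "finite T" for T i
    using that
  proof (induction T arbitrary: i rule: finite_induct)
    case empty
    show ?case
    proof (cases "inj i")
      case False
      then obtain b b' where "b \<noteq> b'" "i b = i b'" by (auto simp: inj_on_def)
      then have "det (\<chi> b. col (i b)) = 0"
        by (intro det_identical_rows[of b b']) (simp_all add: row_def)
      then show ?thesis by simp
    qed (simp add: minors)
  next
    case (insert z T)
    have eq1: "(\<chi> b. if b \<in> insert z T then \<Sum>j\<in>UNIV. M b j *s col j else col (i b)) =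
        (\<chi> b. if b = z then \<Sum>j\<in>UNIV. M z j *s col j
          else if b \<in> T then \<Sum>j\<in>UNIV. M b j *s col j else col (i b))"
      by (simp add: vec_eq_iff)
    have eq2: "(\<chi> b. if b = z then col j else if b \<in> T then \<Sum>j\<in>UNIV. M b j *s col j else col (i b)) =
        (\<chi> b. if b \<in> T then \<Sum>j\<in>UNIV. M b j *s col j else col ((i(z := j)) b))" for j
      using insert.hyps by (auto simp: vec_eq_iff)
    have "det (\<chi> b. if b \<in> insert z T then \<Sum>j\<in>UNIV. M b j *s col j else col (i b)) =
        (\<Sum>j\<in>UNIV. M z j * det (\<chi> b. if b \<in> T then \<Sum>j\<in>UNIV. M b j *s col j else col ((i(z := j)) b)))"
      unfolding eq1 by (simp add: det_linear_row_sum det_row_mul eq2 del: fun_upd_apply)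
    also have "g dvd \<dots>" by (intro dvd_sum dvd_mult insert.IH)
    finally show ?case .
  qed
  from this[of UNIV] show ?thesis by simp
qed

text \<open>Modulo \<open>g\<close> the matrix is diagonal, so only the identity permutation
  contributes to the Leibniz formula.\<close>

lemma prime_dvd_det_diagonal:
  fixes C :: "'a::comm_ring_1^'m^'m"
  assumes g: "prime_elem g" and off: "\<And>a b. a \<noteq> b \<Longrightarrow> g dvd C $ b $ a" and det: "g dvd det C"
  shows "\<exists>b. g dvd C $ b $ b"
proof -
  let ?f = "\<lambda>p. of_int (sign p) * (\<Prod>i\<in>UNIV. C $ i $ p i)"
  let ?P = "{p. p permutes (UNIV :: 'm set)}"
  have "finite ?P" "id \<in> ?P" by (auto simp: finite_permutations permutes_id)
  then have "det C = ?f id + (\<Sum>p\<in>?P - {id}. ?f p)"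
    unfolding det_def by (rule sum.remove)
  moreover have "g dvd (\<Sum>p\<in>?P - {id}. ?f p)"
  proof (intro dvd_sum dvd_mult)
    fix p assume "p \<in> ?P - {id}"
    then obtain i where "p i \<noteq> i" by (auto simp: fun_eq_iff)
    then have "g dvd C $ i $ p i" by (rule off)
    also have "\<dots> dvd (\<Prod>i\<in>UNIV. C $ i $ p i)" by (rule dvd_prodI) auto
    finally show "g dvd (\<Prod>i\<in>UNIV. C $ i $ p i)" .
  qed
  ultimately have "g dvd ?f id" using det by (simp add: dvd_add_left_iff)
  then have dvd: "g dvd (\<Prod>i\<in>UNIV. C $ i $ i)" by (simp add: sign_id)
  have "\<exists>b\<in>A. g dvd C $ b $ b" if "finite A" "g dvd (\<Prod>i\<in>A. C $ i $ i)" for A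
    using that
  proof (induction A rule: finite_induct)
    case (insert x A)
    then show ?case using prime_elem_dvd_multD[OF g] by auto
  qed (use g in \<open>auto simp: prime_elem_def\<close>)
  from this[OF finite dvd] show ?thesis by auto
qed

section \<open>The Jacobian of \<open>f\<close> modulo a fixed prime \<open>g\<close>\<close>

context
  fixes f :: "'m::finite \<Rightarrow> ('n::finite, 'k::field_char_0) mpoly" and g :: "('n, 'k) mpoly"
  assumes g: "prime_elem g"
begin

interpretation P: mpoly_prime_ideal "relations g f"
  by (rule relations_prime_ideal[OF g])

text \<open>Chain rule on the left, product rule on the right. Modulo \<open>g\<close>, the Jacobian
  carries the gradient of \<open>p\<close> at \<open>f\<close> to \<open>h\<close> times the
  gradient of \<open>g\<close>.\<close>

lemma gradient_relation:
  assumes "msubst p f = g * h"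
  shows "(\<Sum>a\<in>UNIV. msubst (mpderiv a p) f * mpderiv j (f a)) = mpderiv j g * h + g * mpderiv j h"
  using mpderiv_msubst[of j p f] by (simp add: assms mpderiv_mult)

section \<open>Some minor prime to \<open>g\<close>: square-freeness is preserved at
  \<open>g\<close>\<close>

context
  fixes i
  assumes minor: "\<not> g dvd jac_minor f i"
begin

text \<open>The columns chosen by \<open>i\<close> form a square matrix whose determinant is prime
  to \<open>g\<close>.\<close>

lemma jacobian_left_cancel:
  assumes "\<And>j. g dvd (\<Sum>a\<in>UNIV. v a * mpderiv j (f a))"
  shows "g dvd v a"
proof -
  have "g dvd v a * jac_minor f i"
    unfolding jac_minor_def by (rule dvd_det_mult) (simp add: assms)
  then show ?thesis using minor prime_elem_dvd_multD[OF g] by blast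
qed

lemma mpderiv_relation:
  assumes "msubst p f = g * h" "g dvd h"
  shows "mpderiv a p \<in> relations g f"
proof -
  have "g dvd msubst (mpderiv a p) f"
    by (rule jacobian_left_cancel) (simp add: gradient_relation[OF assms(1)] assms(2))
  then show ?thesis by (simp add: relations_def)
qed

text \<open>With the weights \<open>hq\<close> and \<open>hp\<close> the multiples of the gradient
  of \<open>g\<close> cancel, and the Jacobian can be cancelled modulo \<open>g\<close>.\<close>

lemma gradients_proportional:
  assumes "msubst p f = g * hp" "msubst q f = g * hq"
  shows "g dvd hq * msubst (mpderiv a p) f - hp * msubst (mpderiv a q) f"
proof (rule jacobian_left_cancel)
  fix j
  have "(\<Sum>a\<in>UNIV. (hq * msubst (mpderiv a p) f - hp * msubst (mpderiv a q) f) * mpderiv j (f a)) =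
      hq * (\<Sum>a\<in>UNIV. msubst (mpderiv a p) f * mpderiv j (f a)) -
      hp * (\<Sum>a\<in>UNIV. msubst (mpderiv a q) f * mpderiv j (f a))"
    by (simp add: left_diff_distrib sum_subtractf sum_distrib_left mult.assoc)
  also have "\<dots> = g * (hq * mpderiv j hp - hp * mpderiv j hq)"
    unfolding gradient_relation[OF assms(1)] gradient_relation[OF assms(2)] by (simp add: algebra_simps)
  finally show "g dvd (\<Sum>a\<in>UNIV. (hq * msubst (mpderiv a p) f - hp * msubst (mpderiv a q) f) * mpderiv j (f a))"
    by simp
qed

lemma squarefree_not_square_dvd:
  assumes w: "squarefree w"
  shows "\<not> g\<^sup>2 dvd msubst w f"
proof
  assume "g\<^sup>2 dvd msubst w f"
  then obtain c where "msubst w f = g\<^sup>2 * c" by (elim dvdE)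
  then have wc: "msubst w f = g * (g * c)" by (simp add: power2_eq_square mult.assoc)
  have wP: "w \<in> relations g f" by (simp add: relations_def wc)
  have dw: "mpderiv a w \<in> relations g f" for a by (rule mpderiv_relation[OF wc]) simp
  have "w \<noteq> 0" using w not_squarefree_0 by metis
  then obtain S t where t: "t \<notin> S" and S: "relations g f \<inter> psub S = {0}"
    and alg: "\<And>t'. t' \<notin> S \<Longrightarrow> \<exists>u. u \<in> relations g f \<and> u \<in> psub (insert t' S) \<and> u \<noteq> 0"
    using P.exists_transcendence_basis[OF wP] by metis
  have principal: "\<exists>r. r \<in> relations g f \<and> r \<in> psub (insert t' S) \<and> irreducible r \<and>
      (\<forall>v. v \<in> relations g f \<longrightarrow> v \<in> psub (insert t' S) \<longrightarrow> r dvd v) \<and> mpderiv t' r \<notin> relations g f"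
    if t': "t' \<notin> S" for t'
  proof -
    obtain u where u: "u \<in> relations g f" "u \<in> psub (insert t' S)" "u \<noteq> 0" using alg[OF t'] by blast
    obtain r where r: "r \<in> relations g f" "r \<in> psub (insert t' S)" "irreducible r" "0 < mdeg t' r"
      "\<And>v. v \<in> relations g f \<Longrightarrow> v \<in> psub (insert t' S) \<Longrightarrow> r dvd v"
      using P.ideal_principal[OF t' S u] by metis
    \<comment> \<open>The derivative stays in \<open>psub (insert t' S)\<close>, where a relation
      would be a multiple of \<open>r\<close>; its degree excludes that.\<close>
    have "mpderiv t' r \<notin> relations g f"
      using r(5)[OF _ psub_mpderiv[OF r(2)]] not_dvd_mpderiv[OF r(4)] by metis
    then show ?thesis using r by metis
  qed
  obtain r where r: "r \<in> relations g f" "r \<in> psub (insert t S)" "irreducible r"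
      "\<And>v. v \<in> relations g f \<Longrightarrow> v \<in> psub (insert t S) \<Longrightarrow> r dvd v" "mpderiv t r \<notin> relations g f"
    using principal[OF t] by metis
  obtain hr where hr: "msubst r f = g * hr" using r(1) by (auto simp: relations_def)
  \<comment> \<open>A second algebraic variable \<open>t'\<close> would give a relation
    \<open>v\<close> free of \<open>t\<close>. Proportionality of the gradients of \<open>r\<close>
    and \<open>v\<close> at \<open>t\<close> then forces \<open>g\<close> to divide
    \<open>hv\<close>, which puts \<open>mpderiv t' v\<close> into the ideal.\<close>
  have UNIV: "insert t S = UNIV"
  proof (rule ccontr)
    assume "insert t S \<noteq> UNIV"
    then obtain t' where t': "t' \<notin> S" "t' \<noteq> t" by auto
    obtain v where v: "v \<in> relations g f" "v \<in> psub (insert t' S)" "mpderiv t' v \<notin> relations g f"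
      using principal[OF t'(1)] by metis
    obtain hv where hv: "msubst v f = g * hv" using v(1) by (auto simp: relations_def)
    have "mpderiv t v = 0"
      using t t'(2) by (intro mpderiv_mdeg_0 mdeg_psub[OF v(2)]) simp
    then have "g dvd hv * msubst (mpderiv t r) f" using gradients_proportional[OF hr hv, of t] by simp
    moreover have "\<not> g dvd msubst (mpderiv t r) f" using r(5) by (simp add: relations_def)
    ultimately have "g dvd hv" using prime_elem_dvd_multD[OF g] by blast
    then show False using mpderiv_relation[OF hv] v(3) by blast
  qed
  have rdvd: "r dvd v" if "v \<in> relations g f" for v using r(4)[of v] that UNIV by simp
  obtain s where s: "w = r * s" using rdvd[OF wP] by (elim dvdE)
  \<comment> \<open>Since \<open>mpderiv t r\<close> lies outside the prime ideal, the derivative of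
    \<open>w = r * s\<close> shows that the cofactor \<open>s\<close> is a relation too.\<close>
  have "mpderiv t r * s + r * mpderiv t s \<in> relations g f" using dw[of t] by (simp add: s mpderiv_mult)
  then have "mpderiv t r * s \<in> relations g f"
    using P.ideal_add_iff P.ideal_mult_right[OF r(1)] by metis
  then have "s \<in> relations g f" using r(5) P.ideal_prime by metis
  then have "r\<^sup>2 dvd w" using rdvd[of s] by (simp add: s power2_eq_square mult_dvd_mono)
  then show False using w r(3) squarefreeD irreducible_not_unit by blast
qed

end

section \<open>The converse: no irreducible \<open>w\<close> with
  \<open>g\<^sup>2 dvd msubst w f\<close>\<close>

context
  assumes irr: "\<And>w. irreducible w \<Longrightarrow> \<not> g\<^sup>2 dvd msubst w f"
begin

text \<open>By the standing assumption \<open>w\<close> is reducible. If one factor is prime to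
  \<open>g\<close> at \<open>f\<close>, then \<open>g\<^sup>2\<close> divides the value of the
  other, which splits by induction and absorbs the first.\<close>

lemma square_dvd_split:
  assumes "w \<noteq> 0" "g\<^sup>2 dvd msubst w f"
  shows "\<exists>a b. w = a * b \<and> a \<in> relations g f \<and> b \<in> relations g f"
  using assms
proof (induction "tdeg w" arbitrary: w rule: less_induct)
  case less
  have "g dvd msubst w f" using less.prems(2) by (metis dvd_mult_left power2_eq_square)
  then have "\<not> w dvd 1" using P.ideal_not_unit[of w] by (simp add: relations_def)
  then obtain a b where ab: "w = a * b" "\<not> a dvd 1" "\<not> b dvd 1"
    using irr less.prems unfolding irreducible_def by metis
  then have n0: "a \<noteq> 0" "b \<noteq> 0" using less.prems by auto
  have sq: "g\<^sup>2 dvd msubst a f * msubst b f" using less.prems(2) by (simp add: ab(1) msubst_mult)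
  have half: "\<exists>x y. a * b = x * y \<and> x \<in> relations g f \<and> y \<in> relations g f"
    if a: "\<not> g dvd msubst a f" and sq: "g\<^sup>2 dvd msubst a f * msubst b f" and ab: "\<not> a dvd 1" "a \<noteq> 0" "b \<noteq> 0"
      and le: "tdeg (a * b) = tdeg w" for a b
  proof -
    have "g dvd msubst a f * msubst b f" using sq by (metis dvd_mult_left power2_eq_square)
    then have "g dvd msubst b f" using a prime_elem_dvd_multD[OF g] by blast
    then obtain z where z: "msubst b f = g * z" by (elim dvdE)
    have "g * g dvd g * (msubst a f * z)" using sq by (simp add: z power2_eq_square mult.left_commute)
    then have "g dvd msubst a f * z" using g by (simp add: mpoly_dvd_mult_cancel_left prime_elem_def)
    then have "g dvd z" using a prime_elem_dvd_multD[OF g] by blast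
    then have "g\<^sup>2 dvd msubst b f" by (simp add: z power2_eq_square mult_dvd_mono)
    moreover have "tdeg b < tdeg w" using ab le by (simp add: tdeg_mult mpoly_unit_iff flip: le)
    ultimately obtain x y where xy: "b = x * y" "x \<in> relations g f" "y \<in> relations g f"
      using less.hyps ab by blast
    have "a * b = (a * x) * y" by (simp add: xy mult.assoc)
    then show ?thesis using xy P.ideal_mult by metis
  qed
  show ?case
  proof (cases "g dvd msubst a f \<and> g dvd msubst b f")
    case True
    then show ?thesis using ab by (auto simp: relations_def)
  next
    case False
    have "g\<^sup>2 dvd msubst b f * msubst a f" using sq by (simp add: mult.commute)
    moreover have "tdeg (a * b) = tdeg w" "tdeg (b * a) = tdeg w" by (simp_all add: ab mult.commute)
    ultimately have "\<exists>x y. a * b = x * y \<and> x \<in> relations g f \<and> y \<in> relations g f"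
      using False half[of a b] half[of b a] sq ab n0 by (metis mult.commute)
    then show ?thesis by (simp add: ab)
  qed
qed

text \<open>Otherwise a \<open>v\<close> of least degree in \<open>t\<close> with leading
  coefficient \<open>l\<close> outside the ideal is a second parameter besides \<open>r\<close>. The
  cusp built from them splits as \<open>a * b\<close> with both factors in the ideal and, by
  minimality, of the degree of \<open>v\<close>. Expanding \<open>a\<close> and \<open>b\<close>
  along \<open>v\<close> and \<open>r\<close> ends with \<open>l * l\<close> in the ideal.\<close>

lemma height_le_one:
  assumes t: "t \<notin> B" and r: "r \<in> relations g f" "r \<in> psub B" "irreducible r"
    and B: "\<And>u. u \<in> relations g f \<Longrightarrow> u \<in> psub B \<Longrightarrow> r dvd u"
    and v: "v \<in> relations g f" "v \<in> psub (insert t B)"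
  shows "lcf t v \<in> relations g f"
proof (rule ccontr)
  let ?P = "relations g f" and ?T = "psub (insert t B) :: ('m, 'k) mpoly set"
  assume "lcf t v \<notin> ?P"
  then obtain v where v: "v \<in> ?P" "v \<in> ?T" "lcf t v \<notin> ?P"
    and min: "\<And>u. u \<in> ?P \<Longrightarrow> u \<in> ?T \<Longrightarrow> lcf t u \<notin> ?P \<Longrightarrow> mdeg t v \<le> mdeg t u"
    using v ex_has_least_nat[of "\<lambda>u. u \<in> ?P \<and> u \<in> ?T \<and> lcf t u \<notin> ?P" v "mdeg t"] by metis
  define l where "l = lcf t v"
  have l: "l \<notin> ?P" "l \<in> ?T" "l \<in> psub B"
    using v psub_lcf[OF v(2)] psub_mono[OF subset_insertI psub_lcf[OF v(2)]] by (simp_all add: l_def)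
  have r0: "r \<noteq> 0" using r(3) by auto
  have v0: "v \<noteq> 0" using v(3) P.ideal_0 by auto
  have rT: "r \<in> ?T" by (rule psub_mono[OF subset_insertI r(2)])
  have rdeg: "mdeg t r = 0" by (rule mdeg_psub[OF r(2) t])
  have prime: "prime_elem r" using r(3) by (rule mpoly_irreducible_imp_prime)
  \<comment> \<open>Minimality of \<open>v\<close> puts the leading coefficient of \<open>u\<close>
    into the ideal, where \<open>r\<close> divides it; the rest of \<open>u\<close> follows by
    induction.\<close>
  have low: "r dvd u" if "u \<in> ?P" "u \<in> ?T" "u = 0 \<or> mdeg t u < mdeg t v" for u
    using that
  proof (induction "mdeg t u" arbitrary: u rule: less_induct)
    case less
    show ?case
    proof (cases "u = 0")
      case False
      have lcu: "lcf t u \<in> ?P" using min[of u] less.prems False by auto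
      have rl: "r dvd lcf t u" by (rule B[OF lcu psub_lcf[OF less.prems(2)]])
      show ?thesis
      proof (cases "mdeg t u = 0")
        case True
        then show ?thesis using rl by (simp add: lcf_mdeg_0)
      next
        case False
        let ?u = "u - lcf t u * mvar t ^ mdeg t u"
        have "lcf t u \<in> ?T" by (rule psub_mono[OF subset_insertI psub_lcf[OF less.prems(2)]])
        then have "?u \<in> ?T" using less.prems by (intro psub_diff psub_mult psub_power psub_var) auto
        moreover have "?u \<in> ?P" using less.prems lcu by (simp add: P.ideal_diff P.ideal_mult_right)
        moreover have "mdeg t ?u < mdeg t u" using False by (intro mdeg_drop_lcf) simp
        ultimately have "r dvd ?u" using less.hyps[of ?u] less.prems \<open>u \<noteq> 0\<close> by auto
        then show ?thesis using rl by (metis diff_add_cancel dvd_add dvd_mult2)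
      qed
    qed simp
  qed
  have d0: "0 < mdeg t v"
  proof (rule ccontr)
    assume "\<not> 0 < mdeg t v"
    then show False using v by (simp add: lcf_mdeg_0)
  qed
  have rv: "\<not> r dvd v"
  proof
    assume "r dvd v"
    then have "r dvd l" unfolding l_def using rdeg by (rule dvd_lcf)
    then show False using r l P.ideal_dvd by blast
  qed
  \<comment> \<open>\<open>r, v\<close> are local parameters at P, and \<open>v\<^sup>2 + r\<^sup>3\<close> is a cusp: singular but unibranch\<close>
  define w where "w = v\<^sup>2 + r ^ 3"
  have deg_v2: "mdeg t (v\<^sup>2) = 2 * mdeg t v" and lcf_v2: "lcf t (v\<^sup>2) = l * l"
    using v0 by (simp_all add: power2_eq_square mdeg_mult lcf_mult l_def)
  have deg_r3: "mdeg t (r ^ 3) = 0" using r0 rdeg by (simp add: mdeg_power)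
  have degw: "mdeg t w = 2 * mdeg t v"
    unfolding w_def deg_v2[symmetric] using deg_v2 deg_r3 d0
    unfolding mdeg_def upoly_add by (intro degree_add_eq_left) simp
  have lcw: "lcf t w = l * l"
  proof -
    have "coeff (upoly t (r ^ 3)) (2 * mdeg t v) = 0"
      by (rule coeff_eq_0) (use deg_r3 d0 in \<open>simp add: mdeg_def\<close>)
    then show ?thesis using degw lcf_v2 deg_v2 unfolding lcf_def mdeg_def
      by (simp add: w_def upoly_add)
  qed
  have w0: "w \<noteq> 0" using degw d0 by auto
  have wT: "w \<in> ?T" unfolding w_def using v rT by (intro psub_add psub_power)
  have "g\<^sup>2 dvd msubst w f"
  proof -
    have "g dvd msubst v f" "g dvd msubst r f" using v r by (simp_all add: relations_def)
    then have "g\<^sup>2 dvd (msubst v f)\<^sup>2" "g\<^sup>2 dvd (msubst r f)\<^sup>2" by (simp_all add: dvd_power_same)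
    then have "g\<^sup>2 dvd (msubst v f)\<^sup>2 + (msubst r f)\<^sup>2 * msubst r f" by simp
    then show ?thesis by (simp add: w_def msubst_add msubst_mult power2_eq_square power3_eq_cube)
  qed
  then obtain a b where w: "w = a * b" "a \<in> ?P" "b \<in> ?P" using square_dvd_split w0 by blast
  have ab0: "a \<noteq> 0" "b \<noteq> 0" using w w0 by auto
  have abT: "a \<in> ?T" "b \<in> ?T" using psub_factor[of a b "insert t B"] w wT w0 by simp_all
  define la where "la = lcf t a"
  define lb where "lb = lcf t b"
  have lab: "la * lb = l * l" using lcw w(1) ab0 by (simp add: lcf_mult la_def lb_def)
  then have labP: "la \<notin> ?P" "lb \<notin> ?P" using P.ideal_mult_iff l(1) by metis+
  have labT: "la \<in> ?T" "lb \<in> ?T"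
    using psub_mono[OF subset_insertI psub_lcf[OF abT(1)]] psub_mono[OF subset_insertI psub_lcf[OF abT(2)]]
    by (simp_all add: la_def lb_def)
  have "mdeg t v \<le> mdeg t a" "mdeg t v \<le> mdeg t b"
    using min w abT labP by (simp_all add: la_def lb_def)
  then have deg: "mdeg t a = mdeg t v" "mdeg t b = mdeg t v"
    using degw w ab0 by (simp_all add: mdeg_mult)
  \<comment> \<open>As \<open>x\<close> and \<open>v\<close> have equal degree, one pseudo-division
    step leaves a relation of smaller degree, a multiple of \<open>r\<close> by
    \<open>low\<close>.\<close>
  have quotient: "\<exists>x'. l * x = lcf t x * v + r * x' \<and> x' \<in> ?T \<and> (x' = 0 \<or> mdeg t x' < mdeg t v)"
    if x: "x \<in> ?P" "x \<in> ?T" "mdeg t x = mdeg t v" "x \<noteq> 0" "lcf t x \<in> ?T" for x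
  proof -
    let ?y = "l * x - lcf t x * v"
    have yP: "?y \<in> ?P" using x v by (simp add: P.ideal_diff P.ideal_mult)
    have yT: "?y \<in> ?T" using x v l by (simp add: psub_diff psub_mult)
    have less: "?y = 0 \<or> mdeg t ?y < mdeg t v"
      using pseudo_reduce[OF x(4) v0, of t] x(3) by (simp add: l_def)
    then have "r dvd ?y" using low yP yT by blast
    then obtain x' where x': "?y = r * x'" by (elim dvdE)
    have "x' \<in> ?T \<and> (x' = 0 \<or> mdeg t x' < mdeg t v)"
    proof (cases "x' = 0")
      case False
      then have "?y \<noteq> 0" using x' r0 by simp
      then have "mdeg t (r * x') < mdeg t v" "r * x' \<in> ?T" "r * x' \<noteq> 0"
        using less yT unfolding x' by blast+
      then show ?thesis using psub_factor(2)[of r x'] False r0 rdeg by (simp add: mdeg_mult)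
    qed simp
    moreover have "l * x = lcf t x * v + r * x'" using x' by (simp add: algebra_simps)
    ultimately show ?thesis by blast
  qed
  obtain a' where a': "l * a = la * v + r * a'" "a' \<in> ?T" "a' = 0 \<or> mdeg t a' < mdeg t v"
    using quotient[OF w(2) abT(1) deg(1) ab0(1)] labT by (auto simp: la_def)
  obtain b' where b': "l * b = lb * v + r * b'" "b' \<in> ?T" "b' = 0 \<or> mdeg t b' < mdeg t v"
    using quotient[OF w(3) abT(2) deg(2) ab0(2)] labT by (auto simp: lb_def)
  \<comment> \<open>Multiplying the two expansions and using \<open>la * lb = l * l\<close>, the
    terms with \<open>v\<^sup>2\<close> cancel and one factor \<open>r\<close> can be divided
    out.\<close>
  have "r * (v * (la * b' + lb * a') + r * a' * b') + l * l * v\<^sup>2 = (la * v + r * a') * (lb * v + r * b')"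
    unfolding lab[symmetric] by (simp add: algebra_simps power2_eq_square)
  also have "\<dots> = l * l * w" unfolding a'(1)[symmetric] b'(1)[symmetric] w(1) by (simp add: mult_ac)
  also have "\<dots> = r * (l * l * r\<^sup>2) + l * l * v\<^sup>2"
    by (simp add: w_def algebra_simps power2_eq_square power3_eq_cube)
  finally have eq1: "v * (la * b' + lb * a') + r * a' * b' = l * l * r\<^sup>2"
    using r0 by (simp add: mpoly_mult_cancel_left)
  have "v * (la * b' + lb * a') = r * (l * l * r - a' * b')"
    using eq1 by (simp add: algebra_simps power2_eq_square)
  then have "r dvd v * (la * b' + lb * a')" by simp
  then have "r dvd la * b' + lb * a'" using rv prime prime_elem_dvd_multD by blast
  then obtain e where e: "la * b' + lb * a' = r * e" by (elim dvdE)
  have "r * (v * e + a' * b') = r * (l * l * r)"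
    using eq1 unfolding e by (simp add: algebra_simps power2_eq_square)
  then have eq2: "v * e + a' * b' = l * l * r" using r0 by (simp add: mpoly_mult_cancel_left)
  \<comment> \<open>Either \<open>a'\<close> or \<open>b'\<close> may be the one in the ideal, so
    the argument is stated for both. Then \<open>r\<close> divides \<open>a'\<close> and
    \<open>e\<close>, \<open>b'\<close> lies in the ideal as well, and dividing by \<open>r\<close>
    writes \<open>l * l\<close> as a combination of \<open>v\<close> and \<open>b'\<close>.\<close>
  have final: False if a': "a' \<in> ?P" "a' \<in> ?T" "a' = 0 \<or> mdeg t a' < mdeg t v"
    and la: "la \<notin> ?P" and e: "la * b' + lb * a' = r * e" and eq: "v * e + a' * b' = l * l * r" for a' b' la lb
  proof -
    have "r dvd a'" using low a' by blast
    then obtain a'' where a'': "a' = r * a''" by (elim dvdE)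
    have "v * e = r * (l * l - a'' * b')" using eq unfolding a'' by (simp add: algebra_simps)
    then have "r dvd v * e" by simp
    then have "r dvd e" using rv prime prime_elem_dvd_multD by blast
    then obtain e' where e': "e = r * e'" by (elim dvdE)
    have "la * b' = r * (e - lb * a'')" using e unfolding a'' by (simp add: algebra_simps)
    then have "la * b' \<in> ?P" using r(1) by (simp add: P.ideal_mult_right)
    then have b': "b' \<in> ?P" using la P.ideal_prime by blast
    have "r * (v * e' + a'' * b') = r * (l * l)" using eq unfolding a'' e' by (simp add: algebra_simps)
    then have "v * e' + a'' * b' = l * l" using r0 by (simp add: mpoly_mult_cancel_left)
    moreover have "v * e' + a'' * b' \<in> ?P" using v b' by (simp add: P.ideal_add P.ideal_mult P.ideal_mult_right)
    ultimately show False using l(1) P.ideal_mult_iff by metis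
  qed
  have "a' * b' = r * (l * l) - v * e" using eq2 by (simp add: algebra_simps)
  then have "a' * b' \<in> ?P" using r v by (simp add: P.ideal_diff P.ideal_mult_right)
  then have "a' \<in> ?P \<or> b' \<in> ?P" by (rule P.ideal_prime)
  then show False
  proof
    assume "a' \<in> ?P"
    then show False using final[of a' la b' lb] a' labP e eq2 by blast
  next
    assume "b' \<in> ?P"
    then show False
      using final[of b' lb a' la] b' labP e eq2 by (simp add: add.commute mult.commute)
  qed
qed

text \<open>\<open>M\<close> solves the Jacobian system for the unit vector at \<open>b\<close>, up
  to the factor \<open>E\<close>. If there are no nonzero relations, every vector is tangent.
  Otherwise they form a principal ideal, and one Jacobian column transverse to it corrects the unit
  vector to a tangent one.\<close>

lemma jacobian_right_inverse:
  "\<exists>E M. \<not> g dvd E \<and> (\<forall>a. g dvd (if a = b then E else 0) - (\<Sum>j\<in>UNIV. M j * mpderiv j (f a)))"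
proof (cases "\<exists>q. q \<in> relations g f \<and> q \<noteq> 0")
  case False
  have kills: "g dvd dirderiv f (\<lambda>a. if a = b then 1 else 0) u" if "u \<in> relations g f" for u
  proof -
    have "u = 0" using False that by blast
    then show ?thesis by simp
  qed
  obtain e \<eta> where e: "\<not> g dvd e"
    "\<forall>a. g dvd e * (if a = b then 1 else 0) - (\<Sum>j\<in>UNIV. \<eta> j * mpderiv j (f a))"
    using tangent_in_jacobian_image[OF g kills] by auto
  have "g dvd (if a = b then e else 0) - (\<Sum>j\<in>UNIV. \<eta> j * mpderiv j (f a))" for a
    using e(2)[rule_format, of a] by (cases "a = b") simp_all
  then show ?thesis using e(1) by (intro exI[of _ e] exI[of _ \<eta>]) simp
next
  case True
  then obtain q where q: "q \<in> relations g f" "q \<noteq> 0" by blast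
  obtain S t where t: "t \<notin> S" and S: "relations g f \<inter> psub S = {0}"
    and alg: "\<And>t'. t' \<notin> S \<Longrightarrow> \<exists>u. u \<in> relations g f \<and> u \<in> psub (insert t' S) \<and> u \<noteq> 0"
    using P.exists_transcendence_basis[OF q] by metis
  obtain u where u: "u \<in> relations g f" "u \<in> psub (insert t S)" "u \<noteq> 0" using alg[OF t] by blast
  obtain r where r: "r \<in> relations g f" "r \<in> psub (insert t S)" "irreducible r"
    "\<And>v. v \<in> relations g f \<Longrightarrow> v \<in> psub (insert t S) \<Longrightarrow> r dvd v"
    using P.ideal_principal[OF t S u] by metis
  \<comment> \<open>A relation \<open>v\<close> for a further variable \<open>t'\<close> would have
    its nonzero leading coefficient in \<open>psub S\<close> and, by \<open>height_le_one\<close>,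
    also in the ideal.\<close>
  have UNIV: "insert t S = UNIV"
  proof (rule ccontr)
    assume "insert t S \<noteq> UNIV"
    then obtain t' where t': "t' \<notin> insert t S" by auto
    then have "t' \<notin> S" by simp
    then obtain v where v: "v \<in> relations g f" "v \<in> psub (insert t' S)" "v \<noteq> 0" using alg by blast
    have "v \<in> psub (insert t' (insert t S))" by (rule psub_mono[OF _ v(2)]) auto
    then have "lcf t' v \<in> relations g f" using height_le_one[OF t' r] v(1) by blast
    then have "lcf t' v \<in> relations g f \<inter> psub S" using psub_lcf[OF v(2)] by simp
    then show False using S v(3) by simp
  qed
  obtain h where h: "msubst r f = g * h" using r(1) by (auto simp: relations_def)
  have "\<not> g dvd h"
  proof
    assume "g dvd h"
    then have "g\<^sup>2 dvd msubst r f" by (simp add: h power2_eq_square mult_dvd_mono)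
    then show False using irr r(3) by blast
  qed
  have "tdeg g \<noteq> 0" using g mpoly_unit_iff[of g] by (auto simp: prime_elem_def)
  then obtain j where "0 < mdeg j g" by (auto simp: tdeg_def)
  then have "\<not> g dvd mpderiv j g" by (rule not_dvd_mpderiv)
  define \<kappa> where "\<kappa> = mpderiv j g * h"
  have \<kappa>: "\<not> g dvd \<kappa>"
    using \<open>\<not> g dvd h\<close> \<open>\<not> g dvd mpderiv j g\<close> prime_elem_dvd_multD[OF g] unfolding \<kappa>_def by blast
  define G where "G = msubst (mpderiv b r) f"
  \<comment> \<open>Column \<open>j\<close> of the Jacobian pairs with the gradient of
    \<open>r\<close> to \<open>\<kappa>\<close> modulo \<open>g\<close>, and the unit vector at
    \<open>b\<close> pairs to \<open>G\<close>; hence this combination is tangent.\<close>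
  define \<delta> where "\<delta> = (\<lambda>a. (if a = b then \<kappa> else 0) - G * mpderiv j (f a))"
  have "dirderiv f \<delta> r = (\<Sum>a\<in>UNIV. if a = b then \<kappa> * msubst (mpderiv a r) f else 0) -
      G * (\<Sum>a\<in>UNIV. msubst (mpderiv a r) f * mpderiv j (f a))"
    unfolding dirderiv_def sum_distrib_left sum_subtractf[symmetric]
    by (intro sum.cong) (auto simp: \<delta>_def algebra_simps)
  also have "\<dots> = - (g * (G * mpderiv j h))"
    unfolding gradient_relation[OF h] by (simp add: \<kappa>_def G_def algebra_simps)
  finally have \<delta>r: "g dvd dirderiv f \<delta> r" by simp
  have kills: "g dvd dirderiv f \<delta> u" if "u \<in> relations g f" for u
  proof -
    have "r dvd u" using r(4)[of u] that UNIV by simp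
    then obtain s where "u = r * s" by (elim dvdE)
    then show ?thesis using \<delta>r by (simp add: dirderiv_mult h mult.assoc)
  qed
  obtain e \<eta> where e: "\<not> g dvd e" "\<forall>a. g dvd e * \<delta> a - (\<Sum>j\<in>UNIV. \<eta> j * mpderiv j (f a))"
    using tangent_in_jacobian_image[OF g kills] by auto
  \<comment> \<open>Adds back the multiple of column \<open>j\<close> that was subtracted in
    \<open>\<delta>\<close>, scaled by \<open>e\<close>.\<close>
  define M where "M = (\<lambda>j'. \<eta> j' + (if j' = j then e * G else 0))"
  have M: "(\<Sum>j'\<in>UNIV. M j' * mpderiv j' (f a)) = (\<Sum>j\<in>UNIV. \<eta> j * mpderiv j (f a)) + e * G * mpderiv j (f a)" for a
  proof -
    have "(\<Sum>j'\<in>UNIV. M j' * mpderiv j' (f a)) =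
        (\<Sum>j'\<in>UNIV. \<eta> j' * mpderiv j' (f a) + (if j' = j then e * G * mpderiv j' (f a) else 0))"
      by (intro sum.cong) (auto simp: M_def algebra_simps)
    then show ?thesis by (simp add: sum.distrib)
  qed
  have "g dvd (if a = b then e * \<kappa> else 0) - (\<Sum>j\<in>UNIV. M j * mpderiv j (f a))" for a
    using e(2)[rule_format, of a] unfolding M \<delta>_def by (cases "a = b") (simp_all add: algebra_simps)
  moreover have "\<not> g dvd e * \<kappa>" using e(1) \<kappa> prime_elem_dvd_multD[OF g, of e \<kappa>] by blast
  ultimately show ?thesis by (intro exI[of _ "e * \<kappa>"] exI[of _ M]) simp
qed

text \<open>The right inverses combine the Jacobian columns into a matrix \<open>C\<close> that is
  diagonal modulo \<open>g\<close> with entries \<open>E b\<close>. If \<open>g\<close> divided all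
  minors it would divide \<open>det C\<close> and thus some \<open>E b\<close>.\<close>

lemma exists_minor_not_dvd: "\<exists>i. inj i \<and> \<not> g dvd jac_minor f i"
proof (rule ccontr)
  assume "\<not> (\<exists>i. inj i \<and> \<not> g dvd jac_minor f i)"
  then have minors: "g dvd jac_minor f i" if "inj i" for i using that by blast
  obtain E where "\<forall>b. \<exists>M. \<not> g dvd E b \<and>
      (\<forall>a. g dvd (if a = b then E b else 0) - (\<Sum>j\<in>UNIV. M j * mpderiv j (f a)))"
    using choice[OF allI[OF jacobian_right_inverse]] by (rule exE)
  from choice[OF this] obtain M where EM: "\<forall>b. \<not> g dvd E b \<and>
      (\<forall>a. g dvd (if a = b then E b else 0) - (\<Sum>j\<in>UNIV. M b j * mpderiv j (f a)))"
    by (rule exE)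
  have E: "\<not> g dvd E b" and M: "g dvd (if a = b then E b else 0) - (\<Sum>j\<in>UNIV. M b j * mpderiv j (f a))" for a b
    using EM by simp_all
  define col :: "'n \<Rightarrow> (('n, 'k) mpoly)^'m" where "col = (\<lambda>j. \<chi> a. mpderiv j (f a))"
  define C where "C = (\<chi> b. \<Sum>j\<in>UNIV. M b j *s col j)"
  have C: "C $ b $ a = (\<Sum>j\<in>UNIV. M b j * mpderiv j (f a))" for a b
    by (simp add: C_def col_def sum_component)
  have "g dvd det C" unfolding C_def
  proof (rule dvd_det_product)
    fix i :: "'m \<Rightarrow> 'n" assume "inj i"
    have "det (\<chi> b. col (i b)) = det (transpose (\<chi> a b. mpderiv (i b) (f a)))"
      by (rule arg_cong[of _ _ det]) (simp add: vec_eq_iff transpose_def col_def)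
    then show "g dvd det (\<chi> b. col (i b))"
      using minors[OF \<open>inj i\<close>] by (simp add: det_transpose jac_minor_def)
  qed
  moreover have "g dvd C $ b $ a" if "a \<noteq> b" for a b using M[of a b] that by (simp add: C)
  ultimately obtain b where "g dvd C $ b $ b" using prime_dvd_det_diagonal[OF g] by blast
  moreover have "g dvd E b - C $ b $ b" using M[of b b] by (simp add: C)
  ultimately have "g dvd E b" by (metis diff_add_cancel dvd_add)
  then show False using E by blast
qed

end

end

section \<open>The gcd of the minors and the equivalence of the three conditions\<close>

lemma dgcd_const_iff:
  fixes f :: "'m::finite \<Rightarrow> ('n::finite, 'k::field_char_0) mpoly"
  shows "(\<exists>d c. is_dgcd f d \<and> c \<noteq> 0 \<and> d = mconst c) \<longleftrightarrow>
    (\<forall>g. irreducible g \<longrightarrow> (\<exists>i. inj i \<and> \<not> g dvd jac_minor f i))"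
proof
  assume "\<exists>d c. is_dgcd f d \<and> c \<noteq> 0 \<and> d = mconst c"
  then obtain c where c: "is_dgcd f (mconst c)" "c \<noteq> 0" by blast
  show "\<forall>g. irreducible g \<longrightarrow> (\<exists>i. inj i \<and> \<not> g dvd jac_minor f i)"
  proof (intro allI impI, rule ccontr)
    fix g :: "('n, 'k) mpoly" assume g: "irreducible g" "\<not> (\<exists>i. inj i \<and> \<not> g dvd jac_minor f i)"
    then have "g dvd mconst c" using c(1) unfolding is_dgcd_def by blast
    then have "g dvd 1" using mconst_unit[OF c(2)] dvd_trans by blast
    then show False using g(1) irreducible_not_unit by blast
  qed
next
  assume irr: "\<forall>g. irreducible g \<longrightarrow> (\<exists>i. inj i \<and> \<not> g dvd jac_minor f i)"
  \<comment> \<open>A nonunit common divisor, 0 included, would have an irreducible factor dividing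
    every minor.\<close>
  have "is_dgcd f 1" unfolding is_dgcd_def
  proof (intro conjI allI impI)
    fix e assume e: "\<forall>i. inj i \<longrightarrow> e dvd jac_minor f i"
    show "e dvd 1"
    proof (rule ccontr)
      assume "\<not> e dvd 1"
      then obtain g where "irreducible g" "g dvd e" using exists_irreducible_dvd by blast
      then show False using irr e dvd_trans by blast
    qed
  qed simp
  then show "\<exists>d c. is_dgcd f d \<and> c \<noteq> 0 \<and> d = mconst c"
    by (intro exI[of _ 1]) simp
qed

lemma irreducible_imp_squarefree: "irreducible w \<Longrightarrow> squarefree w"
proof (rule squarefreeI)
  fix x assume w: "irreducible w" and "x\<^sup>2 dvd w"
  then obtain c where "w = x * (x * c)" by (auto simp: power2_eq_square mult.assoc elim!: dvdE)
  then have "x dvd 1 \<or> x * c dvd 1" using w irreducibleD by blast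
  then show "x dvd 1" using dvd_mult_left by blast
qed

theorem theorem2p4:
  fixes f :: "'m::finite \<Rightarrow> ('n::finite, 'k::field_char_0) mpoly"
  assumes "CARD('m) \<le> CARD('n)"
    and "alg_indep f"
  shows "((\<exists>d c. is_dgcd f d \<and> c \<noteq> 0 \<and> d = mconst c)
            \<longleftrightarrow> (\<forall>w :: ('m, 'k) mpoly. irreducible w \<longrightarrow> squarefree (msubst w f)))
       \<and> ((\<forall>w :: ('m, 'k) mpoly. irreducible w \<longrightarrow> squarefree (msubst w f))
            \<longleftrightarrow> (\<forall>w :: ('m, 'k) mpoly. squarefree w \<longrightarrow> squarefree (msubst w f)))"
    (is "(?dgcd \<longleftrightarrow> ?irr) \<and> (?irr \<longleftrightarrow> ?sqf)")
proof -
  \<comment> \<open>The equivalences come from the cycle \<open>?dgcd\<close>, \<open>?sqf\<close>,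
    \<open>?irr\<close>, \<open>?dgcd\<close>.\<close>
  have "?sqf" if ?dgcd
  proof (intro allI impI squarefreeI)
    fix w :: "('m, 'k) mpoly" and x assume w: "squarefree w" and x: "x\<^sup>2 dvd msubst w f"
    show "x dvd 1"
    proof (rule ccontr)
      assume "\<not> x dvd 1"
      then obtain g where g: "irreducible g" "g dvd x" using exists_irreducible_dvd by blast
      then obtain i where "\<not> g dvd jac_minor f i" using \<open>?dgcd\<close> unfolding dgcd_const_iff by blast
      moreover have "g\<^sup>2 dvd msubst w f" using dvd_power_same[OF g(2)] x dvd_trans by blast
      ultimately show False
        using squarefree_not_square_dvd[OF mpoly_irreducible_imp_prime[OF g(1)] _ w] by blast
    qed
  qed
  moreover have ?irr if ?sqf using that irreducible_imp_squarefree by blast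
  moreover have ?dgcd if ?irr
    unfolding dgcd_const_iff
  proof (intro allI impI)
    fix g :: "('n, 'k) mpoly" assume g: "irreducible g"
    show "\<exists>i. inj i \<and> \<not> g dvd jac_minor f i"
    proof (rule exists_minor_not_dvd[OF mpoly_irreducible_imp_prime[OF g]])
      fix w :: "('m, 'k) mpoly" assume "irreducible w"
      then have "squarefree (msubst w f)" using that by blast
      then show "\<not> g\<^sup>2 dvd msubst w f" using g squarefreeD irreducible_not_unit by blast
    qed
  qed
  ultimately show ?thesis by blast
qed

end
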